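(* Let $h\in\mathbb{R}^{(2n-1)p\times m}$ be the first $2n-1$ impulse-response coefficients of a system with $p$ inputs and $m$ outputs, stacked as $h=[h_1;\dots;h_{2n-1}]$ with $h_j\in\mathbb{R}^{p\times m}$. Let $\bar U\in\mathbb{R}^{T\times(2n-1)p}$ be an input matrix obtained from multiple rollouts with i.i.d. standard normal entries, let $z\in\mathbb{R}^{T\times m}$ be a noise matrix with i.i.d. $\mathcal{N}(0,\sigma_z^2)$ entries, and let $y=\bar U h+z$. Let $\hat h$ be the least-squares solution $\hat h=\arg\min_{h'}\tfrac12\|\bar U h'-y\|_F^2=h+\bar U^\dagger z$. Then, when $T\gtrsim mnp$, the spectral norm error obeys $$\|\mathcal{H}(\hat h-h)\|\lesssim\sigma_z\sqrt{\frac{mnp}{T}}\,\log(np).$$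
   Context: $\mathcal{H}(h)\in\mathbb{R}^{mn\times pn}$ is the block Hankel matrix whose $(j,k)$ block ($1\le j,k\le n$) is $h_{j+k-1}^\top\in\mathbb{R}^{m\times p}$. $\|\cdot\|$ denotes the spectral norm, $\|\cdot\|_F$ the Frobenius norm, $\bar U^\dagger$ the Moore–Penrose pseudo-inverse. The notation $a\lesssim b$ means $a\le c\,b$ for an absolute constant $c>0$ (and $\gtrsim$ similarly).
   Formalization: The error bound is stated with high probability, namely at least 1 − c₃(np)^(−c₄) for absolute constants c₃, c₄ > 0, since it cannot hold surely and log(np) = 0 when np = 1; U and z are taken independent and σ_z > 0. *)

theory Defs
  imports "HOL-Probability.Probability"
begin

text \<open>Real matrices are represented as functions on index pairs (0-based);
  dimensions are passed explicitly.  Products are restricted to their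
  dimensions (entries outside are 0).\<close>

type_synonym rmat = "nat \<times> nat \<Rightarrow> real"

definition mres :: "nat \<Rightarrow> nat \<Rightarrow> rmat \<Rightarrow> rmat" where
  "mres r c A = (\<lambda>(i,j). if i < r \<and> j < c then A (i,j) else 0)"

definition mmul :: "nat \<Rightarrow> nat \<Rightarrow> nat \<Rightarrow> rmat \<Rightarrow> rmat \<Rightarrow> rmat" where
  "mmul r k c A B = (\<lambda>(i,j). if i < r \<and> j < c then (\<Sum>l<k. A (i,l) * B (l,j)) else 0)"

definition mtrans :: "rmat \<Rightarrow> rmat" where
  "mtrans A = (\<lambda>(i,j). A (j,i))"

definition is_pinv :: "nat \<Rightarrow> nat \<Rightarrow> rmat \<Rightarrow> rmat \<Rightarrow> bool" where
  "is_pinv r c A X \<longleftrightarrow>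
     mres c r X = X \<and>
     mmul r r c (mmul r c r A X) A = mres r c A \<and>
     mmul c r r (mmul c r c X A) X = X \<and>
     mtrans (mmul r c r A X) = mmul r c r A X \<and>
     mtrans (mmul c r c X A) = mmul c r c X A"

definition pinv :: "nat \<Rightarrow> nat \<Rightarrow> rmat \<Rightarrow> rmat" where
  "pinv r c A = (THE X. is_pinv r c A X)"

definition spec_norm :: "nat \<Rightarrow> nat \<Rightarrow> rmat \<Rightarrow> real" where
  "spec_norm r c A =
     Sup {sqrt (\<Sum>i<r. (\<Sum>j<c. A (i,j) * x j)\<^sup>2) | x. (\<Sum>j<c. (x j)\<^sup>2) \<le> 1}"

text \<open>Block Hankel matrix of g ((2n-1)p x m, blocks g_1..g_{2n-1} of size p x m):
  an mn x pn matrix whose (J,K) block (0-based) is the transpose of block J+K of g.\<close>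
definition hankel :: "nat \<Rightarrow> nat \<Rightarrow> nat \<Rightarrow> rmat \<Rightarrow> rmat" where
  "hankel n m p g = (\<lambda>(i,j). if i < m * n \<and> j < p * n
       then g ((i div m + j div p) * p + j mod p, i mod m) else 0)"

definition gauss_mat :: "nat \<Rightarrow> nat \<Rightarrow> real \<Rightarrow> rmat measure" where
  "gauss_mat r c \<sigma> = PiM ({..<r} \<times> {..<c}) (\<lambda>_. density lborel (normal_density 0 \<sigma>))"

definition ls_est :: "nat \<Rightarrow> nat \<Rightarrow> nat \<Rightarrow> rmat \<Rightarrow> rmat \<Rightarrow> rmat \<Rightarrow> rmat" where
  "ls_est T d m U h z = mmul d T m (pinv T d U) (\<lambda>ij. mmul T d m U h ij + z ij)"

end

theory Submission
  imports Defs "Jordan_Normal_Form.Determinant"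
begin

text \<open>
  On the event \<open>\<parallel>U x\<parallel>\<^sup>2 \<ge> T/16 \<parallel>x\<parallel>\<^sup>2\<close> for all \<open>x\<close>, the error is \<open>U\<^sup>\<dagger> z\<close> with
  \<open>\<parallel>(U\<^sup>\<dagger>)\<^sup>T v\<parallel>\<^sup>2 \<le> 16 \<parallel>v\<parallel>\<^sup>2 / T\<close>. That event has overwhelming probability by a union bound over
  the grid of mesh \<open>1/(10 \<surd>d)\<close>, which has only \<open>exp (O(d))\<close> points in the unit ball, with
  Gaussian tails \<open>exp (- T/10)\<close>. A block Hankel matrix is a corner of a block
  cyclic matrix of order \<open>2n - 1\<close>, which the discrete Fourier transform block-diagonalises; so its spectral
  norm is at most the largest Frobenius norm of a Fourier coefficient of its symbol. For
  fixed \<open>U\<close>, the squared Frobenius norm of such a coefficient is a sum of \<open>2mp\<close> squares of centred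
  Gaussians of variance at most \<open>16 (2n - 1) \<sigma>\<^sup>2 / T\<close>; it has an exponential moment, and a union
  bound over the \<open>2n - 1\<close> frequencies gives the claim, with \<open>\<surd>ln (np)\<close> in place of \<open>ln (np)\<close>.
\<close>

section \<open>The pseudo-inverse\<close>

lemma mmul_assoc:
  "mmul r k' c (mmul r k k' A B) C = mmul r k c A (mmul k k' c B C)"
proof -
  have "(\<Sum>l<k'. (\<Sum>l'<k. A (i, l') * B (l', l)) * C (l, j)) =
        (\<Sum>l<k. A (i, l) * (\<Sum>l'<k'. B (l, l') * C (l', j)))" for i j
    unfolding sum_distrib_left sum_distrib_right
    by (subst sum.swap) (simp add: mult.assoc)
  then show ?thesis
    by (auto simp: mmul_def fun_eq_iff intro!: sum.cong)
qed

lemma mtrans_mmul: "mtrans (mmul r k c A B) = mmul c k r (mtrans B) (mtrans A)"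
  by (auto simp: mtrans_def mmul_def fun_eq_iff mult.commute)

lemma mmul_mres_left: "mmul r k c (mres r k A) B = mmul r k c A B"
  by (auto simp: mmul_def mres_def fun_eq_iff)

lemma mmul_mres_right: "mmul r k c A (mres k c B) = mmul r k c A B"
  by (auto simp: mmul_def mres_def fun_eq_iff)

text \<open>The inner dimension in the third equation of \<^const>\<open>is_pinv\<close> is \<open>r\<close> rather than \<open>c\<close>;
  for \<open>c \<le> r\<close> this makes no difference, as the first factor vanishes beyond column \<open>c\<close>.\<close>

lemma mmul_inner_dim:
  "c \<le> r \<Longrightarrow> mmul c r r (mmul c k c X A) Y = mmul c c r (mmul c k c X A) Y"
  by (auto simp: mmul_def fun_eq_iff intro!: sum.mono_neutral_cong_right split: if_splits)

text \<open>Penrose's argument. Each of the symmetric matrices \<open>AX\<close> and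
  \<open>AY\<close> fixes the other under left multiplication, so transposing one of these
  identities gives \<open>AX = AY\<close>; in the same way \<open>XA = YA\<close>. Then
  \<open>X = XAX = YAX = YAY = Y\<close>.\<close>

lemma is_pinv_unique:
  assumes cr: "c \<le> r" and X: "is_pinv r c A X" and Y: "is_pinv r c A Y"
  shows "X = Y"
proof -
  define AX where "AX = mmul r c r A X"
  define AY where "AY = mmul r c r A Y"
  define XA where "XA = mmul c r c X A"
  define YA where "YA = mmul c r c Y A"
  note defs = AX_def AY_def XA_def YA_def
  have sym: "mtrans AX = AX" "mtrans AY = AY" "mtrans XA = XA" "mtrans YA = YA"
    using X Y by (auto simp: is_pinv_def defs)
  have AXA: "mmul r r c AX A = mres r c A" and AYA: "mmul r r c AY A = mres r c A"
    using X Y by (auto simp: is_pinv_def defs)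
  have "mmul r r r AY AX = mmul r c r (mmul r r c AY A) X"
    unfolding AX_def by (simp add: mmul_assoc)
  also have "\<dots> = AX"
    unfolding AYA by (simp add: AX_def mmul_mres_left)
  finally have 1: "mmul r r r AY AX = AX" .
  have "mmul r r r AX AY = mmul r c r (mmul r r c AX A) Y"
    unfolding AY_def by (simp add: mmul_assoc)
  also have "\<dots> = AY"
    unfolding AXA by (simp add: AY_def mmul_mres_left)
  finally have 2: "mmul r r r AX AY = AY" .
  have AXY: "AX = AY"
    using arg_cong[OF 1, of mtrans] unfolding mtrans_mmul sym 2 by simp
  have AXA': "mmul r c c A XA = mres r c A" and AYA': "mmul r c c A YA = mres r c A"
    using AXA AYA by (auto simp: defs mmul_assoc)
  have "mmul c c c XA YA = mmul c r c X (mmul r c c A YA)"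
    unfolding XA_def by (simp add: mmul_assoc)
  also have "\<dots> = XA"
    unfolding AYA' by (simp add: XA_def mmul_mres_right)
  finally have 3: "mmul c c c XA YA = XA" .
  have "mmul c c c YA XA = mmul c r c Y (mmul r c c A XA)"
    unfolding YA_def by (simp add: mmul_assoc)
  also have "\<dots> = YA"
    unfolding AXA' by (simp add: YA_def mmul_mres_right)
  finally have 4: "mmul c c c YA XA = YA" .
  have XYA: "XA = YA"
    using arg_cong[OF 3, of mtrans] unfolding mtrans_mmul sym 4 by simp
  have "X = mmul c c r XA X"
    using X by (auto simp: is_pinv_def defs mmul_inner_dim[OF cr])
  also have "\<dots> = mmul c r r Y AX"
    unfolding XYA by (simp add: YA_def AX_def mmul_assoc)
  also have "\<dots> = mmul c c r YA Y"
    unfolding AXY by (simp add: YA_def AY_def mmul_assoc)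
  also have "\<dots> = Y"
    using Y by (auto simp: is_pinv_def defs mmul_inner_dim[OF cr])
  finally show ?thesis .
qed

lemma pinv_eqI: "c \<le> r \<Longrightarrow> is_pinv r c A X \<Longrightarrow> pinv r c A = X"
  unfolding pinv_def using is_pinv_unique by blast

text \<open>The quadratic form of the Gram matrix at \<open>x\<close> is the squared norm of
  \<open>A x\<close>, so injectivity of \<open>A\<close> makes the Gram matrix nonsingular.
  \<open>S\<close> is its inverse, obtained from the determinant criterion.\<close>

lemma gram_inverse:
  fixes A :: rmat
  assumes inj: "\<And>x. (\<forall>i<r. (\<Sum>j<c. A (i,j) * x j) = 0) \<Longrightarrow> \<forall>j<c. x j = 0"
  obtains S where "\<And>i j. i < c \<Longrightarrow> j < c \<Longrightarrow>
      (\<Sum>k<c. S (i,k) * (\<Sum>l<r. A (l,k) * A (l,j))) = (if i = j then 1 else 0)"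
    and "\<And>i j. i < c \<Longrightarrow> j < c \<Longrightarrow> S (i,j) = S (j,i)"
proof -
  define g where "g i j = (\<Sum>l<r. A (l,i) * A (l,j))" for i j
  define G where "G = Matrix.mat c c (\<lambda>(i,j). g i j)"
  have G: "G \<in> carrier_mat c c" by (simp add: G_def)
  have "Determinant.det G \<noteq> 0"
  proof
    assume "Determinant.det G = 0"
    then obtain v where v: "v \<in> carrier_vec c" "v \<noteq> 0\<^sub>v c" "G *\<^sub>v v = 0\<^sub>v c"
      using det_0_iff_vec_prod_zero_field[OF G] by auto
    define x where "x j = vec_index v j" for j
    have row: "(\<Sum>j<c. g i j * x j) = 0" if "i < c" for i
    proof -
      have "vec_index (G *\<^sub>v v) i = (\<Sum>j<c. g i j * x j)"
        using that v(1) by (simp add: G_def scalar_prod_def x_def atLeast0LessThan)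
      then show ?thesis using that v(3) by simp
    qed
    have "(\<Sum>l<r. (\<Sum>j<c. A (l,j) * x j)\<^sup>2) = (\<Sum>l<r. \<Sum>i<c. \<Sum>j<c. x i * (A (l,i) * A (l,j) * x j))"
      by (simp add: power2_eq_square sum_product algebra_simps)
    also have "\<dots> = (\<Sum>i<c. x i * (\<Sum>j<c. g i j * x j))"
      unfolding g_def sum_distrib_left sum_distrib_right
      by (subst sum.swap, rule sum.cong, simp, subst sum.swap, simp)
    also have "\<dots> = 0" by (simp add: row)
    finally have "\<forall>l<r. (\<Sum>j<c. A (l,j) * x j) = 0"
      by (subst (asm) sum_nonneg_eq_0_iff) auto
    then have "\<forall>j<c. x j = 0" using inj by blast
    then have "v = 0\<^sub>v c" using v(1) by (intro eq_vecI) (auto simp: x_def)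
    with v(2) show False by simp
  qed
  from det_non_zero_imp_unit[OF G this]
  obtain B where B: "B \<in> carrier_mat c c" "B * G = 1\<^sub>m c" "G * B = 1\<^sub>m c"
    unfolding Units_def ring_mat_def by auto
  have Gt: "transpose_mat G = G"
    by (rule eq_matI) (auto simp: G_def g_def mult.commute)
  \<comment> \<open>Symmetry of \<open>G\<close> passes to its inverse:
    \<open>B^T = B^T (G B) = (G B)^T B = B\<close>.\<close>
  have "transpose_mat B = transpose_mat B * (G * B)"
    using B by simp
  also have "\<dots> = transpose_mat B * transpose_mat G * B"
    using B G by (simp add: Gt)
  also have "\<dots> = transpose_mat (G * B) * B"
    using B G by (subst transpose_mult[OF G B(1)]) simp
  also have "\<dots> = B" unfolding B(3) using B by simp
  finally have Bt: "transpose_mat B = B" .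
  show ?thesis
  proof (rule that[of "\<lambda>(i,j). index_mat B (i,j)"])
    fix i j assume ij: "i < c" "j < c"
    have "index_mat (B * G) (i,j) = (\<Sum>k<c. index_mat B (i,k) * g k j)"
      using ij B(1) by (simp add: scalar_prod_def G_def atLeast0LessThan)
    then show "(\<Sum>k<c. (case (i, k) of (i, j) \<Rightarrow> index_mat B (i,j)) * (\<Sum>l<r. A (l, k) * A (l, j))) = (if i = j then 1 else 0)"
      using ij by (simp add: B(2) g_def)
  next
    fix i j assume ij: "i < c" "j < c"
    have "index_mat (transpose_mat B) (i,j) = index_mat B (j,i)"
      using ij B(1) by simp
    then show "(case (i,j) of (i, j) \<Rightarrow> index_mat B (i,j)) = (case (j,i) of (i, j) \<Rightarrow> index_mat B (i,j))"
      by (simp add: Bt)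
  qed
qed

text \<open>The witness is \<open>(A^T A)^{-1} A^T\<close>. Being a left inverse of
  \<open>A\<close>, it satisfies all Penrose equations at once except the symmetry of
  \<open>A X = A S A^T\<close>, which comes from the symmetry of \<open>S\<close>.\<close>

lemma pinv_exists_injective:
  assumes cr: "c \<le> r" and inj: "\<And>x. (\<forall>i<r. (\<Sum>j<c. A (i,j) * x j) = 0) \<Longrightarrow> \<forall>j<c. x j = 0"
  shows "\<exists>X. is_pinv r c A X"
    and "mmul c r c (pinv r c A) A = (\<lambda>(i,j). if i < c \<and> j < c \<and> i = j then 1 else 0)"
proof -
  let ?I = "\<lambda>(i,j). if i < c \<and> j < c \<and> i = j then 1 else (0::real)"
  obtain S where S: "\<And>i j. i < c \<Longrightarrow> j < c \<Longrightarrow>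
      (\<Sum>k<c. S (i,k) * (\<Sum>l<r. A (l,k) * A (l,j))) = (if i = j then 1 else 0)"
    and S_sym: "\<And>i j. i < c \<Longrightarrow> j < c \<Longrightarrow> S (i,j) = S (j,i)"
    using gram_inverse[OF inj] by blast
  define X where "X = mmul c c r S (mtrans A)"
  have X_res: "mres c r X = X"
    by (auto simp: X_def mres_def mmul_def)
  have XA: "mmul c r c X A = ?I"
    unfolding X_def mmul_assoc
    by (auto simp: mmul_def mtrans_def fun_eq_iff S)
  have I_right: "mmul a c c B ?I = mres a c B" for a B
    by (auto simp: mmul_def mres_def fun_eq_iff if_distrib[of "(*) _"] sum.delta' cong: if_cong)
  have I_left: "mmul c c b ?I B = mres c b B" for b B
    by (auto simp: mmul_def mres_def fun_eq_iff if_distrib[of "\<lambda>u. u * _"] sum.delta cong: if_cong)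
  have St: "mmul r c c A (mtrans S) = mmul r c c A S"
    by (auto simp: mmul_def mtrans_def fun_eq_iff S_sym intro!: sum.cong)
  have tt: "mtrans (mtrans B) = B" for B by (auto simp: mtrans_def)
  have "mtrans (mmul r c r A X) = mmul r c r A X"
    unfolding X_def mtrans_mmul tt by (simp add: mmul_assoc[symmetric] St)
  then have "is_pinv r c A X"
    unfolding is_pinv_def mmul_inner_dim[OF cr] using X_res
    by (auto simp: mmul_assoc[of r r c c A X A] XA I_right I_left) (auto simp: mtrans_def)
  then show "\<exists>X. is_pinv r c A X" "mmul c r c (pinv r c A) A = ?I"
    using XA pinv_eqI[OF cr] by auto
qed

text \<open>Put \<open>w = X^T v\<close> and \<open>u = X w\<close>. Symmetry of \<open>A X\<close>
  gives \<open>A u = (X A X)^T v = w\<close>, so the lower bound on \<open>A\<close> controls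
  \<open>u\<close> by \<open>w\<close>. Since the squared norm \<open>W\<close> of \<open>w\<close>
  equals the inner product of \<open>u\<close> and \<open>v\<close>, Cauchy-Schwarz closes the
  loop.\<close>

lemma pinv_transpose_bound:
  assumes cr: "c \<le> r" and X: "is_pinv r c A X" and s: "s > 0"
    and lower: "\<And>x. s * (\<Sum>j<c. (x j)\<^sup>2) \<le> (\<Sum>i<r. (\<Sum>j<c. A (i,j) * x j)\<^sup>2)"
  shows "(\<Sum>i<r. (\<Sum>j<c. X (j,i) * v j)\<^sup>2) \<le> (\<Sum>j<c. (v j)\<^sup>2) / s"
proof -
  define w where "w i = (\<Sum>j<c. X (j,i) * v j)" for i
  define u where "u j = (\<Sum>i<r. X (j,i) * w i)" for j
  define W where "W = (\<Sum>i<r. (w i)\<^sup>2)"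
  have XAX: "mmul c r r X (mmul r c r A X) = X" and sym: "mtrans (mmul r c r A X) = mmul r c r A X"
    using X by (auto simp: is_pinv_def mmul_inner_dim[OF cr] mmul_assoc[of c c r r X A X])
  \<comment> \<open>This is \<open>X = X (A X)\<close> with the symmetric factor \<open>A X\<close>
    read with its indices exchanged.\<close>
  have Xeq: "X (j,i) = (\<Sum>l<r. X (j,l) * (\<Sum>k<c. A (i,k) * X (k,l)))" if "j < c" "i < r" for i j
  proof -
    have "X (j,i) = (\<Sum>l<r. X (j,l) * mmul r c r A X (l,i))"
      using fun_cong[OF XAX, of "(j,i)"] that by (simp add: mmul_def)
    also have "\<dots> = (\<Sum>l<r. X (j,l) * mmul r c r A X (i,l))"
      using fun_cong[OF sym, of "(_,i)"] by (simp add: mtrans_def)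
    finally show ?thesis using that by (simp add: mmul_def)
  qed
  have Au: "(\<Sum>k<c. A (i,k) * u k) = w i" if "i < r" for i
  proof -
    have "w i = (\<Sum>j<c. \<Sum>l<r. \<Sum>k<c. X (j,l) * A (i,k) * X (k,l) * v j)"
      unfolding w_def by (intro sum.cong refl, subst Xeq)
        (use that in \<open>auto simp: sum_distrib_left sum_distrib_right algebra_simps\<close>)
    also have "\<dots> = (\<Sum>l<r. \<Sum>j<c. \<Sum>k<c. X (j,l) * A (i,k) * X (k,l) * v j)"
      by (rule sum.swap)
    also have "\<dots> = (\<Sum>l<r. \<Sum>k<c. \<Sum>j<c. X (j,l) * A (i,k) * X (k,l) * v j)"
      by (intro sum.cong refl sum.swap)
    also have "\<dots> = (\<Sum>k<c. \<Sum>l<r. \<Sum>j<c. X (j,l) * A (i,k) * X (k,l) * v j)"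
      by (rule sum.swap)
    also have "\<dots> = (\<Sum>k<c. A (i,k) * u k)"
      by (simp add: u_def w_def sum_distrib_left sum_distrib_right algebra_simps)
    finally show ?thesis by simp
  qed
  have uW: "s * (\<Sum>j<c. (u j)\<^sup>2) \<le> W"
    using lower[of u] by (simp add: Au W_def)
  have "W = (\<Sum>j<c. u j * v j)"
  proof -
    have "W = (\<Sum>i<r. \<Sum>j<c. w i * X (j,i) * v j)"
      unfolding W_def power2_eq_square by (subst (2) w_def) (simp add: sum_distrib_left algebra_simps)
    also have "\<dots> = (\<Sum>j<c. u j * v j)"
      by (subst sum.swap) (simp add: u_def sum_distrib_left sum_distrib_right algebra_simps)
    finally show ?thesis .
  qed
  then have "W\<^sup>2 \<le> (\<Sum>j<c. (u j)\<^sup>2) * (\<Sum>j<c. (v j)\<^sup>2)"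
    using Cauchy_Schwarz_ineq_sum[of u v "{..<c}"] by simp
  also have "\<dots> \<le> W / s * (\<Sum>j<c. (v j)\<^sup>2)"
    using uW s by (intro mult_right_mono) (auto simp: field_simps sum_nonneg)
  finally have "W * W \<le> W * ((\<Sum>j<c. (v j)\<^sup>2) / s)" by (simp add: power2_eq_square)
  moreover have "W \<ge> 0" by (simp add: W_def sum_nonneg)
  moreover have "(\<Sum>j<c. (v j)\<^sup>2) / s \<ge> 0" using s by (simp add: sum_nonneg)
  \<comment> \<open>One factor \<open>W\<close> cancels; for \<open>W = 0\<close> the bound only
    needs its right side to be nonnegative.\<close>
  ultimately have "W \<le> (\<Sum>j<c. (v j)\<^sup>2) / s"
    by (metis mult_le_cancel_left_pos order_le_less)
  then show ?thesis by (simp add: W_def w_def)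
qed

section \<open>Measurability\<close>

text \<open>Tychonoff's theorem: the box is a product of compact intervals, and the function type
  carries the product topology.\<close>

lemma compact_box_fun: "compact {f :: 'a \<Rightarrow> real. \<forall>i. \<bar>f i\<bar> \<le> b}"
proof -
  have "compactin (product_topology (\<lambda>i::'a. euclidean) UNIV) (PiE UNIV (\<lambda>i. {-b..b}))"
    by (simp add: compactin_PiE)
  moreover have "PiE UNIV (\<lambda>i::'a. {-b..b}) = {f. \<forall>i. \<bar>f i\<bar> \<le> b}"
    by (auto simp: PiE_def Pi_iff abs_le_iff) (metis minus_le_iff neg_le_iff_le)+
  ultimately show ?thesis
    by (simp add: euclidean_product_topology)
qed

text \<open>Projection along a compact factor is a closed map (the tube lemma).\<close>

lemma closed_projection_compact:
  fixes C :: "('a::topological_space \<times> 'b::topological_space) set"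
  assumes C: "closed C" and K: "compact K"
  shows "closed {x. \<exists>y\<in>K. (x, y) \<in> C}"
proof -
  have "closed_map (prod_topology euclidean (top_of_set K)) (euclidean :: 'a topology) fst"
    by (rule Abstract_Topological_Spaces.closed_map_fst) (use K in \<open>simp add: compact_space_subtopology\<close>)
  moreover have "closedin (prod_topology (euclidean :: 'a topology) (top_of_set K)) (C \<inter> UNIV \<times> K)"
  proof -
    have "prod_topology (euclidean :: 'a topology) (top_of_set K) = top_of_set (UNIV \<times> K)"
      by (metis prod_topology_subtopology_eu subtopology_UNIV)
    then show ?thesis
      using C closedin_closed_Int by (metis inf_commute)
  qed
  ultimately have "closed (fst ` (C \<inter> UNIV \<times> K))"
    unfolding closed_map_def by auto
  moreover have "fst ` (C \<inter> UNIV \<times> K) = {x. \<exists>y\<in>K. (x, y) \<in> C}"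
    by force
  ultimately show ?thesis by simp
qed

text \<open>Each Penrose equation equates entries that are polynomials in finitely many coordinates
  of \<open>A\<close> and \<open>X\<close>, hence continuous in the product topology.\<close>

lemma closed_is_pinv: "closed {(A, X). is_pinv r c A X}"
proof -
  have fst: "continuous_on UNIV (\<lambda>q::rmat \<times> rmat. fst q ij)" for ij
    by (rule continuous_on_product_then_coordinatewise) (intro continuous_intros)
  have snd: "continuous_on UNIV (\<lambda>q::rmat \<times> rmat. snd q ij)" for ij
    by (rule continuous_on_product_then_coordinatewise) (intro continuous_intros)
  have mmul: "continuous_on UNIV (\<lambda>q. mmul a k b (F q) (G q) ij)"
    if "\<And>ij. continuous_on UNIV (\<lambda>q. F q ij)" "\<And>ij. continuous_on UNIV (\<lambda>q. G q ij)"
    for a k b ij and F G :: "rmat \<times> rmat \<Rightarrow> rmat"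
    by (cases "fst ij < a \<and> snd ij < b"; cases ij) (auto simp: mmul_def intro!: continuous_intros that)
  have mres: "continuous_on UNIV (\<lambda>q. mres a b (F q) ij)"
    if "\<And>ij. continuous_on UNIV (\<lambda>q. F q ij)" for a b ij and F :: "rmat \<times> rmat \<Rightarrow> rmat"
    by (cases "fst ij < a \<and> snd ij < b"; cases ij) (auto simp: mres_def intro!: continuous_intros that)
  have mtrans: "continuous_on UNIV (\<lambda>q. mtrans (F q) ij)"
    if "\<And>ij. continuous_on UNIV (\<lambda>q. F q ij)" for ij and F :: "rmat \<times> rmat \<Rightarrow> rmat"
    by (cases ij) (auto simp: mtrans_def intro!: that)
  have eq: "{(A, X). is_pinv r c A X} = {q. is_pinv r c (fst q) (snd q)}"
    by auto
  show ?thesis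
    unfolding eq
    unfolding is_pinv_def fun_eq_iff
    by (intro closed_Collect_conj closed_Collect_all closed_Collect_eq mmul mres mtrans fst snd)
qed

text \<open>The projection of a closed set along a countable union of compact fibres is Borel; this makes
  \<^const>\<open>pinv\<close> measurable on all matrices without a formula for it, and without knowing
  whether a pseudo-inverse exists.\<close>

lemma borel_pinv_pred:
  assumes "\<And>X. Q X \<longleftrightarrow> (\<exists>k::nat. R k X)" and "\<And>k. closed {X. R k X}"
  shows "{A. \<exists>X. is_pinv r c A X \<and> Q X} \<in> sets borel"
proof -
  have "{A. \<exists>X. is_pinv r c A X \<and> Q X} = (\<Union>k. \<Union>l::nat. {A. \<exists>X\<in>{X. \<forall>i. \<bar>X i\<bar> \<le> real l}. 
      (A, X) \<in> {(A, X). is_pinv r c A X} \<inter> {q. R k (snd q)}})" (is "_ = ?R")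
  proof
    show "?R \<subseteq> {A. \<exists>X. is_pinv r c A X \<and> Q X}"
      using assms(1) by auto
    show "{A. \<exists>X. is_pinv r c A X \<and> Q X} \<subseteq> ?R"
    proof
      fix A assume "A \<in> {A. \<exists>X. is_pinv r c A X \<and> Q X}"
      then obtain X k where X: "is_pinv r c A X" "R k X" using assms(1) by auto
      \<comment> \<open>The first clause of \<open>is_pinv\<close> makes \<open>X\<close> vanish
        outside finitely many entries, so \<open>X\<close> lies in one of the countably many compact
        boxes.\<close>
      define B where "B = (\<Sum>i\<in>{..<c} \<times> {..<r}. \<bar>X i\<bar>)"
      have "\<bar>X i\<bar> \<le> B" for i
      proof (cases "i \<in> {..<c} \<times> {..<r}")
        case True then show ?thesis unfolding B_def by (intro member_le_sum) auto
      next
        case False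
        have "X i = mres c r X i" using X(1) by (simp add: is_pinv_def)
        also have "\<dots> = 0" using False by (cases i) (auto simp: mres_def)
        finally show ?thesis by (simp add: B_def sum_nonneg)
      qed
      moreover obtain l :: nat where "B \<le> real l" using real_arch_simple by blast
      ultimately have "\<forall>i. \<bar>X i\<bar> \<le> real l" by (meson order_trans)
      then show "A \<in> ?R" using X by auto
    qed
  qed
  also have "\<dots> \<in> sets borel"
  proof -
    have "closed (snd -` {X. R k X} :: (rmat \<times> rmat) set)" for k
      by (intro continuous_closed_vimage assms(2)) (auto intro: continuous_intros)
    then have "closed {q :: rmat \<times> rmat. R k (snd q)}" for k by (simp add: vimage_def)
    then have "closed {A. \<exists>X\<in>{X. \<forall>i. \<bar>X i\<bar> \<le> real l}.
        (A, X) \<in> {(A, X). is_pinv r c A X} \<inter> {q. R k (snd q)}}" for k l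
      by (rule closed_projection_compact[OF closed_Int[OF closed_is_pinv] compact_box_fun])
    then show ?thesis by (intro sets.countable_UN' borel_closed) auto
  qed
  finally show ?thesis .
qed

text \<open>By uniqueness, a strict lower bound on an entry of \<open>pinv\<close> amounts to the
  existence of a pseudo-inverse with that property. The strict inequality is a countable union of
  closed conditions, so \<open>borel_pinv_pred\<close> applies.\<close>

lemma borel_measurable_pinv:
  assumes cr: "c \<le> r"
  shows "(\<lambda>A. pinv r c A ij) \<in> borel_measurable borel"
proof -
  define D where "D = {A. \<exists>X. is_pinv r c A X}"
  \<comment> \<open>Where no pseudo-inverse exists, \<open>THE\<close> is applied to the constantly
    false predicate and so returns the same matrix \<open>u\<close> for every
    \<open>A\<close>.\<close>
  define u where "u = (THE X::rmat. False)"
  have D: "D \<in> sets borel"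
    unfolding D_def using borel_pinv_pred[of "\<lambda>_. True" "\<lambda>_ _. True" r c] by simp
  have u: "pinv r c A = u" if "A \<notin> D" for A
  proof -
    have "is_pinv r c A = (\<lambda>_. False)" using that by (auto simp: D_def)
    then show ?thesis by (simp add: pinv_def u_def)
  qed
  show ?thesis
  proof (rule borel_measurableI_greater)
    fix a
    have gt: "X ij > a \<longleftrightarrow> (\<exists>k::nat. X ij \<ge> a + inverse (Suc k))" for X :: rmat
    proof
      assume "X ij > a"
      then obtain k where "inverse (real (Suc k)) < X ij - a"
        using reals_Archimedean[of "X ij - a"] by auto
      then show "\<exists>k::nat. X ij \<ge> a + inverse (Suc k)" by (intro exI[of _ k]) simp
    next
      assume "\<exists>k::nat. X ij \<ge> a + inverse (Suc k)"
      then obtain k :: nat where "X ij \<ge> a + inverse (Suc k)" by auto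
      moreover have "inverse (real (Suc k)) > 0" by simp
      ultimately show "X ij > a" by linarith
    qed
    have E: "{A. \<exists>X. is_pinv r c A X \<and> X ij > a} \<in> sets borel"
      by (rule borel_pinv_pred[OF gt]) (intro closed_Collect_le continuous_intros continuous_on_product_then_coordinatewise)
    have "{A. pinv r c A ij > a} = {A. \<exists>X. is_pinv r c A X \<and> X ij > a} \<union> (if u ij > a then - D else {})"
      using u pinv_eqI[OF cr] by (auto simp: D_def split: if_splits)
    also have "\<dots> \<in> sets borel" using E D by auto
    finally show "{A \<in> space borel. a < pinv r c A ij} \<in> sets borel" by simp
  qed
qed

section \<open>The spectral norm as a supremum, and its closed sublevel sets\<close>

lemma bdd_above_spec_norm:
  fixes A :: rmat
  shows "bdd_above {sqrt (\<Sum>i<r. (\<Sum>j<c. A (i,j) * x j)\<^sup>2) | x. (\<Sum>j<c. (x j)\<^sup>2) \<le> (1::real)}"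
proof (rule bdd_aboveI, clarify)
  fix x :: "nat \<Rightarrow> real" assume x: "(\<Sum>j<c. (x j)\<^sup>2) \<le> 1"
  \<comment> \<open>Cauchy-Schwarz in each row bounds the set by the Frobenius norm. Boundedness is
    what gives the real \<open>Sup\<close> its meaning.\<close>
  have "(\<Sum>i<r. (\<Sum>j<c. A (i,j) * x j)\<^sup>2) \<le> (\<Sum>i<r. \<Sum>j<c. (A (i,j))\<^sup>2)"
  proof (rule sum_mono)
    fix i
    have "(\<Sum>j<c. A (i,j) * x j)\<^sup>2 \<le> (\<Sum>j<c. (A (i,j))\<^sup>2) * (\<Sum>j<c. (x j)\<^sup>2)"
      by (rule Cauchy_Schwarz_ineq_sum)
    also have "\<dots> \<le> (\<Sum>j<c. (A (i,j))\<^sup>2) * 1"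
      using x by (intro mult_left_mono) (auto simp: sum_nonneg)
    finally show "(\<Sum>j<c. A (i,j) * x j)\<^sup>2 \<le> (\<Sum>j<c. (A (i,j))\<^sup>2)" by simp
  qed
  then show "sqrt (\<Sum>i<r. (\<Sum>j<c. A (i,j) * x j)\<^sup>2) \<le> sqrt (\<Sum>i<r. \<Sum>j<c. (A (i,j))\<^sup>2)"
    by simp
qed

lemma spec_norm_le_iff:
  "spec_norm r c A \<le> b \<longleftrightarrow>
    (\<forall>x. (\<Sum>j<c. (x j)\<^sup>2) \<le> 1 \<longrightarrow> sqrt (\<Sum>i<r. (\<Sum>j<c. A (i,j) * x j)\<^sup>2) \<le> b)"
proof -
  have "{sqrt (\<Sum>i<r. (\<Sum>j<c. A (i,j) * x j)\<^sup>2) | x. (\<Sum>j<c. (x j)\<^sup>2) \<le> (1::real)} \<noteq> {}"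
    by (auto intro: exI[of _ "\<lambda>_. 0"])
  from cSup_le_iff[OF this bdd_above_spec_norm] show ?thesis
    unfolding spec_norm_def by auto
qed

text \<open>An arbitrary intersection of closed sets is closed, so the supremum over uncountably
  many \<open>x\<close> needs no reduction to a countable dense set.\<close>

lemma closed_spec_norm_le: "closed {A. spec_norm r c A \<le> b}"
proof -
  have "{A. spec_norm r c A \<le> b} =
    (\<Inter>x\<in>{x. (\<Sum>j<c. (x j)\<^sup>2) \<le> 1}. {A. sqrt (\<Sum>i<r. (\<Sum>j<c. A (i,j) * x j)\<^sup>2) \<le> b})"
    unfolding spec_norm_le_iff by auto
  also have "closed \<dots>"
    by (intro closed_INT ballI closed_Collect_le continuous_intros continuous_on_product_then_coordinatewise)
  finally show ?thesis .
qed

section \<open>Measurability of the error event\<close>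

lemma space_gauss_mat: "space (gauss_mat r c \<sigma>) = PiE ({..<r} \<times> {..<c}) (\<lambda>_. UNIV)"
  by (simp add: gauss_mat_def space_PiM)

text \<open>Off the index rectangle every point of the product space takes the constant value
  \<open>undefined\<close>, so all coordinates are measurable, not only the random ones.\<close>

lemma measurable_gauss_mat_coord: "(\<lambda>A. A ij) \<in> borel_measurable (gauss_mat r c \<sigma>)"
proof (cases "ij \<in> {..<r} \<times> {..<c}")
  case True
  then show ?thesis unfolding gauss_mat_def
    by (auto intro!: measurable_component_singleton simp: measurable_cong_sets[OF refl sets_density])
next
  case False
  have "A ij = undefined" if "A \<in> space (gauss_mat r c \<sigma>)" for A
    using that False unfolding space_gauss_mat by (cases ij) (auto simp: PiE_def extensional_def)
  then show ?thesis by (subst measurable_cong[of _ _ "\<lambda>_. undefined"]) auto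
qed

lemma borel_measurable_gauss_mat: "(\<lambda>A. A) \<in> borel_measurable (gauss_mat r c \<sigma>)"
  by (intro measurable_coordinatewise_then_product measurable_gauss_mat_coord)

text \<open>\<open>measure\<close> is 0 on sets that are not measurable, so a lower bound for the
  probability of this event, reached through its complement, rests on its measurability.\<close>

lemma sets_spec_norm_error:
  assumes "d \<le> T"
  shows "{Uz \<in> space (gauss_mat T d 1 \<Otimes>\<^sub>M gauss_mat T m \<sigma>).
      spec_norm (m * n) (p * n)
        (hankel n m p (\<lambda>ij. ls_est T d m (fst Uz) h (snd Uz) ij - h ij)) \<le> b}
    \<in> sets (gauss_mat T d 1 \<Otimes>\<^sub>M gauss_mat T m \<sigma>)" (is "{Uz \<in> space ?M. _} \<in> _")
proof -
  have U: "(\<lambda>Uz. fst Uz) \<in> measurable ?M borel"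
    by (rule measurable_compose[OF measurable_fst borel_measurable_gauss_mat])
  have Ui [measurable]: "(\<lambda>Uz. fst Uz ij) \<in> borel_measurable ?M" for ij
    by (rule measurable_compose[OF measurable_fst measurable_gauss_mat_coord])
  have zi [measurable]: "(\<lambda>Uz. snd Uz ij) \<in> borel_measurable ?M" for ij
    by (rule measurable_compose[OF measurable_snd measurable_gauss_mat_coord])
  have pi [measurable]: "(\<lambda>Uz. pinv T d (fst Uz) ij) \<in> borel_measurable ?M" for ij
    by (rule measurable_compose[OF U borel_measurable_pinv[OF assms]])
  have mm: "(\<lambda>q. mmul a k b (F q) (G q) ij) \<in> borel_measurable ?M"
    if [measurable]: "\<And>ij. (\<lambda>q. F q ij) \<in> borel_measurable ?M" "\<And>ij. (\<lambda>q. G q ij) \<in> borel_measurable ?M"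
    for a k b ij F G
    by (cases ij) (auto simp: mmul_def)
  have ls [measurable]: "(\<lambda>Uz. ls_est T d m (fst Uz) h (snd Uz) ij) \<in> borel_measurable ?M" for ij
    unfolding ls_est_def by (intro mm pi borel_measurable_add zi Ui) auto
  have "(\<lambda>Uz. hankel n m p (\<lambda>ij. ls_est T d m (fst Uz) h (snd Uz) ij - h ij)) \<in> borel_measurable ?M"
  proof (rule measurable_coordinatewise_then_product)
    fix ij show "(\<lambda>Uz. hankel n m p (\<lambda>ij. ls_est T d m (fst Uz) h (snd Uz) ij - h ij) ij) \<in> borel_measurable ?M"
      by (cases ij) (auto simp: hankel_def)
  qed
  from measurable_sets[OF this borel_closed[OF closed_spec_norm_le[of "m*n" "p*n" b]]]
  show ?thesis by (simp add: vimage_def Int_def conj_commute)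
qed

section \<open>Exponential moments of Gaussian matrices\<close>

text \<open>With \<open>q = 1 - 2 * l * s^2\<close>, the factor \<open>exp (l * x^2)\<close> turns
  the centred normal density of variance \<open>s^2\<close> into \<open>1 / sqrt q\<close> times the
  one of variance \<open>s^2 / q\<close>, which integrates to 1.\<close>

lemma nn_integral_exp_square_normal:
  assumes s: "s > 0" and l: "2 * l * s\<^sup>2 < 1"
  shows "(\<integral>\<^sup>+x. ennreal (exp (l * x\<^sup>2)) * ennreal (normal_density 0 s x) \<partial>lborel)
    = ennreal (1 / sqrt (1 - 2 * l * s\<^sup>2))"
proof -
  define q where "q = 1 - 2 * l * s\<^sup>2"
  define s' where "s' = s / sqrt q"
  have q: "q > 0" using l by (simp add: q_def)
  have s': "s' > 0" using s q by (simp add: s'_def)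
  have s'2: "s'\<^sup>2 = s\<^sup>2 / q" using q by (simp add: s'_def power_divide)
  have eq: "exp (l * x\<^sup>2) * normal_density 0 s x = 1 / sqrt q * normal_density 0 s' x" for x
  proof -
    have "l * x\<^sup>2 + - (x - 0)\<^sup>2 / (2 * s\<^sup>2) = - (x - 0)\<^sup>2 / (2 * s'\<^sup>2)"
      using s q unfolding s'2 by (simp add: field_simps q_def)
    then have "exp (l * x\<^sup>2) * exp (- (x - 0)\<^sup>2 / (2 * s\<^sup>2)) = exp (- (x - 0)\<^sup>2 / (2 * s'\<^sup>2))"
      by (simp only: exp_add[symmetric])
    moreover have "1 / sqrt (2 * pi * s\<^sup>2) = 1 / sqrt q * (1 / sqrt (2 * pi * s'\<^sup>2))"
      using s q unfolding s'2 by (simp add: real_sqrt_mult real_sqrt_divide)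
    ultimately show ?thesis
      unfolding normal_density_def by (simp add: mult.assoc mult.left_commute)
  qed
  have "(\<integral>\<^sup>+x. ennreal (exp (l * x\<^sup>2)) * ennreal (normal_density 0 s x) \<partial>lborel)
    = (\<integral>\<^sup>+x. ennreal (1 / sqrt q) * ennreal (normal_density 0 s' x) \<partial>lborel)"
    using s s' q by (simp add: ennreal_mult'[symmetric] eq)
  also have "\<dots> = ennreal (1 / sqrt q) * (\<integral>\<^sup>+x. ennreal (normal_density 0 s' x) \<partial>lborel)"
    by (rule nn_integral_cmult) simp
  also have "(\<integral>\<^sup>+x. ennreal (normal_density 0 s' x) \<partial>lborel) = 1"
    using s' by (subst nn_integral_eq_integral) auto
  finally show ?thesis by (simp add: q_def)
qed

section \<open>Independence of the entries and laws of their linear forms\<close>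

lemma prob_space_gauss_mat: "\<sigma> > 0 \<Longrightarrow> prob_space (gauss_mat r c \<sigma>)"
  unfolding gauss_mat_def by (intro prob_space_PiM prob_space_normal_density)

lemma gauss_mat_indep:
  assumes "\<sigma> > 0"
  shows "prob_space.indep_vars (gauss_mat r c \<sigma>) (\<lambda>_. borel) (\<lambda>i A. A i) ({..<r} \<times> {..<c})"
proof -
  let ?N = "density lborel (normal_density 0 \<sigma>)"
  interpret P: prob_space "gauss_mat r c \<sigma>" by (rule prob_space_gauss_mat[OF assms])
  have N: "prob_space ?N" by (rule prob_space_normal_density[OF assms])
  have rv: "(\<lambda>A. A i) \<in> measurable (gauss_mat r c \<sigma>) ?N" if "i \<in> {..<r} \<times> {..<c}" for i
    using that unfolding gauss_mat_def by measurable
  have "P.indep_vars (\<lambda>_. ?N) (\<lambda>i A. A i) ({..<r} \<times> {..<c})"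
  \<comment> \<open>\<open>indep_vars_iff_distr_eq_PiM'\<close> speaks of nonempty families; the
    empty one is independent by definition.\<close>
  proof (cases "{..<r} \<times> {..<c} = {}")
    case True
    then show ?thesis unfolding P.indep_vars_def P.indep_sets_def by auto
  next
    case False
    have id: "distr (gauss_mat r c \<sigma>) (\<Pi>\<^sub>M i\<in>{..<r} \<times> {..<c}. ?N) (\<lambda>x. \<lambda>i\<in>{..<r} \<times> {..<c}. x i) = gauss_mat r c \<sigma>"
    proof -
      have "distr (gauss_mat r c \<sigma>) (\<Pi>\<^sub>M i\<in>{..<r} \<times> {..<c}. ?N) (\<lambda>x. \<lambda>i\<in>{..<r} \<times> {..<c}. x i)
        = distr (gauss_mat r c \<sigma>) (gauss_mat r c \<sigma>) (\<lambda>x. x)"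
        by (rule distr_cong) (auto simp: gauss_mat_def space_PiM)
      then show ?thesis by simp
    qed
    have comp: "distr (gauss_mat r c \<sigma>) ?N (\<lambda>x. x i) = ?N" if "i \<in> {..<r} \<times> {..<c}" for i
      unfolding gauss_mat_def using that N by (intro distr_PiM_component) auto
    have iff: "P.indep_vars (\<lambda>_. ?N) (\<lambda>i A. A i) ({..<r} \<times> {..<c}) \<longleftrightarrow>
        distr (gauss_mat r c \<sigma>) (\<Pi>\<^sub>M i\<in>{..<r} \<times> {..<c}. ?N) (\<lambda>x. \<lambda>i\<in>{..<r} \<times> {..<c}. x i)
        = (\<Pi>\<^sub>M i\<in>{..<r} \<times> {..<c}. distr (gauss_mat r c \<sigma>) ?N (\<lambda>x. x i))"
      by (rule P.indep_vars_iff_distr_eq_PiM'[OF False rv])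
    show ?thesis
      unfolding iff id
      unfolding gauss_mat_def by (intro PiM_cong) (auto simp: comp[unfolded gauss_mat_def])
  qed
  from P.indep_vars_compose2[OF this, of "\<lambda>_ x. x" "\<lambda>_. borel"]
  show ?thesis by simp
qed

lemma gauss_mat_coord_distributed:
  assumes "\<sigma> > 0" "i \<in> {..<r} \<times> {..<c}"
  shows "distributed (gauss_mat r c \<sigma>) lborel (\<lambda>A. A i) (normal_density 0 \<sigma>)"
proof -
  let ?N = "density lborel (normal_density 0 \<sigma>)"
  have N: "prob_space ?N" by (rule prob_space_normal_density[OF assms(1)])
  have "distr (gauss_mat r c \<sigma>) ?N (\<lambda>x. x i) = ?N"
    unfolding gauss_mat_def using assms N by (intro distr_PiM_component) auto
  moreover have "distr (gauss_mat r c \<sigma>) ?N (\<lambda>x. x i) = distr (gauss_mat r c \<sigma>) lborel (\<lambda>x. x i)"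
    by (rule distr_cong) auto
  moreover have "(\<lambda>A. A i) \<in> measurable (gauss_mat r c \<sigma>) ?N"
    using assms unfolding gauss_mat_def by measurable
  ultimately show ?thesis
    unfolding distributed_def by (auto simp: measurable_cong_sets[OF refl sets_density])
qed

lemma gauss_mat_linear_distributed:
  assumes \<sigma>: "\<sigma> > 0" and I: "I \<subseteq> {..<r} \<times> {..<c}" and w: "\<exists>i\<in>I. w i \<noteq> 0"
  shows "distributed (gauss_mat r c \<sigma>) lborel (\<lambda>A. \<Sum>i\<in>I. w i * A i)
    (normal_density 0 (\<sigma> * sqrt (\<Sum>i\<in>I. (w i)\<^sup>2)))"
proof -
  interpret P: prob_space "gauss_mat r c \<sigma>" by (rule prob_space_gauss_mat[OF \<sigma>])
  \<comment> \<open>A summand with weight 0 has no density, so the sum of independent normals is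
    formed over the nonzero weights only.\<close>
  define J where "J = {i\<in>I. w i \<noteq> 0}"
  have fin: "finite I" using I finite_subset by blast
  have J: "finite J" "J \<noteq> {}" "J \<subseteq> {..<r} \<times> {..<c}" using fin w I by (auto simp: J_def)
  have "P.indep_vars (\<lambda>_. borel) (\<lambda>i A. A i) J"
    by (rule P.indep_vars_subset[OF gauss_mat_indep[OF \<sigma>] J(3)])
  then have "P.indep_vars (\<lambda>_. borel) (\<lambda>i A. w i * A i) J"
    by (rule P.indep_vars_compose2[of _ _ _ "\<lambda>i x. w i * x"]) auto
  moreover have "distributed (gauss_mat r c \<sigma>) lborel (\<lambda>A. w i * A i) (normal_density 0 (\<bar>w i\<bar> * \<sigma>))"
    if "i \<in> J" for i
    using P.normal_density_affine[OF gauss_mat_coord_distributed[OF \<sigma>, of i r c] \<sigma>, of "w i" 0] that J(3)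
    by (auto simp: J_def)
  ultimately have "distributed (gauss_mat r c \<sigma>) lborel (\<lambda>A. \<Sum>i\<in>J. w i * A i)
      (normal_density (\<Sum>i\<in>J. 0) (sqrt (\<Sum>i\<in>J. (\<bar>w i\<bar> * \<sigma>)\<^sup>2)))"
    using \<sigma> by (intro P.sum_indep_normal J) (auto simp: J_def)
  moreover have "(\<Sum>i\<in>J. w i * A i) = (\<Sum>i\<in>I. w i * A i)" for A :: rmat
    unfolding J_def using fin by (intro sum.mono_neutral_left) auto
  moreover have "(\<Sum>i\<in>J. (\<bar>w i\<bar> * \<sigma>)\<^sup>2) = \<sigma>\<^sup>2 * (\<Sum>i\<in>I. (w i)\<^sup>2)"
    unfolding sum_distrib_left J_def using fin
    by (intro sum.mono_neutral_cong_left) (auto simp: power_mult_distrib)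
  ultimately show ?thesis
    using \<sigma> by (simp add: real_sqrt_mult)
qed

text \<open>The sign of \<open>l\<close> is left open because the upper tail uses a positive and the
  lower tail a negative exponent. If all weights vanish, the form has no density, but both sides are
  1.\<close>

lemma gauss_mat_exp_square:
  assumes \<sigma>: "\<sigma> > 0" and I: "I \<subseteq> {..<r} \<times> {..<c}" and l: "2 * l * (\<sigma>\<^sup>2 * (\<Sum>i\<in>I. (w i)\<^sup>2)) < 1"
  shows "(\<integral>\<^sup>+A. ennreal (exp (l * (\<Sum>i\<in>I. w i * A i)\<^sup>2)) \<partial>gauss_mat r c \<sigma>)
    = ennreal (1 / sqrt (1 - 2 * l * (\<sigma>\<^sup>2 * (\<Sum>i\<in>I. (w i)\<^sup>2))))"
proof (cases "\<exists>i\<in>I. w i \<noteq> 0")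
  case True
  have fin: "finite I" using I finite_subset by blast
  define W where "W = (\<Sum>i\<in>I. (w i)\<^sup>2)"
  have W: "W > 0" unfolding W_def using True fin by (auto intro!: sum_pos2)
  have sq: "(\<sigma> * sqrt W)\<^sup>2 = \<sigma>\<^sup>2 * W" using W by (simp add: power_mult_distrib)
  have "(\<integral>\<^sup>+A. ennreal (exp (l * (\<Sum>i\<in>I. w i * A i)\<^sup>2)) \<partial>gauss_mat r c \<sigma>)
      = (\<integral>\<^sup>+x. ennreal (normal_density 0 (\<sigma> * sqrt W) x) * ennreal (exp (l * x\<^sup>2)) \<partial>lborel)"
    using gauss_mat_linear_distributed[OF \<sigma> I True, folded W_def]
    by (intro distributed_nn_integral[symmetric]) auto
  also have "\<dots> = ennreal (1 / sqrt (1 - 2 * l * (\<sigma> * sqrt W)\<^sup>2))"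
    by (subst mult.commute, rule nn_integral_exp_square_normal)
      (use \<sigma> W l in \<open>auto simp: sq W_def[symmetric]\<close>)
  finally show ?thesis unfolding sq unfolding W_def .
next
  case False
  interpret P: prob_space "gauss_mat r c \<sigma>" by (rule prob_space_gauss_mat[OF \<sigma>])
  show ?thesis using False P.emeasure_space_1 by simp
qed

text \<open>Rows are disjoint blocks of independent entries, so the exponential of the sum over rows
  integrates to a product of \<open>r\<close> equal factors.\<close>

lemma gauss_mat_exp_norm_square:
  assumes \<sigma>: "\<sigma> > 0" and l: "2 * l * (\<sigma>\<^sup>2 * (\<Sum>j<c. (y j)\<^sup>2)) < 1"
  shows "(\<integral>\<^sup>+A. ennreal (exp (l * (\<Sum>i<r. (\<Sum>j<c. A (i,j) * y j)\<^sup>2))) \<partial>gauss_mat r c \<sigma>)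
    = ennreal ((1 / sqrt (1 - 2 * l * (\<sigma>\<^sup>2 * (\<Sum>j<c. (y j)\<^sup>2)))) ^ r)"
proof -
  interpret P: prob_space "gauss_mat r c \<sigma>" by (rule prob_space_gauss_mat[OF \<sigma>])
  define K where "K i = {i} \<times> {..<c}" for i :: nat
  define w where "w q = y (snd q)" for q :: "nat \<times> nat"
  have sumK: "(\<Sum>q\<in>K i. f q) = (\<Sum>j<c. f (i,j))" for i and f :: "nat \<times> nat \<Rightarrow> real"
    unfolding K_def by (rule sum.reindex_bij_witness[of _ "\<lambda>j. (i,j)" snd]) auto
  have KI: "K i \<subseteq> {..<r} \<times> {..<c}" if "i < r" for i using that by (auto simp: K_def)
  define F where "F i A = ennreal (exp (l * (\<Sum>q\<in>K i. w q * A q)\<^sup>2))" for i and A :: rmat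
  have "P.indep_vars (\<lambda>i. PiM (K i) (\<lambda>_. borel)) (\<lambda>i A. restrict (\<lambda>q. A q) (K i)) {..<r}"
    by (rule P.indep_vars_restrict[OF gauss_mat_indep[OF \<sigma>]])
      (auto simp: KI K_def disjoint_family_on_def)
  then have "P.indep_vars (\<lambda>_. borel) (\<lambda>i A. F i (restrict A (K i))) {..<r}"
  proof (rule P.indep_vars_compose2)
    fix i show "F i \<in> borel_measurable (PiM (K i) (\<lambda>_. borel))"
      unfolding F_def by measurable
  qed
  moreover have "F i (restrict A (K i)) = F i A" for i A
    unfolding F_def by simp
  ultimately have "P.indep_vars (\<lambda>_. borel) F {..<r}"
    by (simp add: eta_contract_eq)
  then have "(\<integral>\<^sup>+A. (\<Prod>i<r. F i A) \<partial>gauss_mat r c \<sigma>) = (\<Prod>i<r. \<integral>\<^sup>+A. F i A \<partial>gauss_mat r c \<sigma>)"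
    by (intro P.indep_vars_nn_integral) auto
  also have "\<dots> = (\<Prod>i<r. ennreal (1 / sqrt (1 - 2 * l * (\<sigma>\<^sup>2 * (\<Sum>j<c. (y j)\<^sup>2)))))"
  proof (rule prod.cong)
    fix i assume "i \<in> {..<r}"
    then show "(\<integral>\<^sup>+A. F i A \<partial>gauss_mat r c \<sigma>) = ennreal (1 / sqrt (1 - 2 * l * (\<sigma>\<^sup>2 * (\<Sum>j<c. (y j)\<^sup>2))))"
      unfolding F_def using gauss_mat_exp_square[OF \<sigma> KI, of i l w] l
      by (auto simp: sumK w_def)
  qed simp
  also have "\<dots> = ennreal ((1 / sqrt (1 - 2 * l * (\<sigma>\<^sup>2 * (\<Sum>j<c. (y j)\<^sup>2)))) ^ r)"
    using l by (simp add: ennreal_power)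
  also have "(\<integral>\<^sup>+A. (\<Prod>i<r. F i A) \<partial>gauss_mat r c \<sigma>) =
      (\<integral>\<^sup>+A. ennreal (exp (l * (\<Sum>i<r. (\<Sum>j<c. A (i,j) * y j)\<^sup>2))) \<partial>gauss_mat r c \<sigma>)"
    by (simp add: F_def prod_ennreal sumK w_def sum_distrib_left exp_sum mult.commute)
  finally show ?thesis .
qed

lemma (in prob_space) exp_Markov:
  assumes [measurable]: "f \<in> borel_measurable M"
    and E: "(\<integral>\<^sup>+x. ennreal (exp (f x)) \<partial>M) \<le> ennreal B" and B: "B \<ge> 0"
  shows "prob {x \<in> space M. f x \<ge> t} \<le> B * exp (- t)"
proof -
  have "emeasure M {x \<in> space M. f x \<ge> t} \<le> (\<integral>\<^sup>+x. ennreal (exp (- t)) * ennreal (exp (f x)) \<partial>M)"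
  proof -
    have "emeasure M {x \<in> space M. f x \<ge> t} = (\<integral>\<^sup>+x. indicator {x \<in> space M. f x \<ge> t} x \<partial>M)"
      by (rule nn_integral_indicator[symmetric]) measurable
    also have "\<dots> \<le> (\<integral>\<^sup>+x. ennreal (exp (- t)) * ennreal (exp (f x)) \<partial>M)"
      by (intro nn_integral_mono)
        (auto simp: indicator_def ennreal_mult'[symmetric] exp_add[symmetric])
    finally show ?thesis .
  qed
  also have "\<dots> = ennreal (exp (- t)) * (\<integral>\<^sup>+x. ennreal (exp (f x)) \<partial>M)"
    by (rule nn_integral_cmult) measurable
  also have "\<dots> \<le> ennreal (exp (- t)) * ennreal B"
    by (intro mult_left_mono E) auto
  also have "\<dots> = ennreal (B * exp (- t))"
    using B by (simp add: ennreal_mult mult.commute)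
  finally show ?thesis
    using B by (simp add: emeasure_eq_measure)
qed

section \<open>The smallest singular value of a Gaussian matrix\<close>

text \<open>Only the bound by 3, uniform in \<open>R\<close>, matters later: it is the source of
  \<open>3 ^ d\<close> in the count of lattice points.\<close>

lemma sum_half_power_abs: "(\<Sum>k\<in>{- int R..int R}. (1/2::real) ^ nat \<bar>k\<bar>) = 3 - 2 * (1/2) ^ R"
proof (induction R)
  case (Suc R)
  have "{- int (Suc R)..int (Suc R)} = insert (int (Suc R)) (insert (- int (Suc R)) {- int R..int R})"
    by auto
  moreover have "nat \<bar>int (Suc R)\<bar> = Suc R" "nat \<bar>- int (Suc R)\<bar> = Suc R" by linarith+
  ultimately show ?case using Suc.IH by simp
qed simp

lemma abs_le_square_int: "\<bar>k\<bar> \<le> k\<^sup>2" for k :: int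
proof (cases "k = 0")
  case False
  then have "\<bar>k\<bar> * 1 \<le> \<bar>k\<bar> * \<bar>k\<bar>" by (intro mult_left_mono) auto
  then show ?thesis by (simp add: power2_eq_square abs_mult_self_eq)
qed simp

text \<open>The integer points of the ball of radius \<open>sqrt R\<close>. Extensional functions
  identify vectors that agree below \<open>d\<close>, so that the points can be counted.\<close>

definition lattice_ball :: "nat \<Rightarrow> nat \<Rightarrow> (nat \<Rightarrow> int) set" where
  "lattice_ball d R = {k \<in> PiE {..<d} (\<lambda>_. {- int R..int R}). (\<Sum>i<d. (k i)\<^sup>2) \<le> int R}"

lemma finite_lattice_ball: "finite (lattice_ball d R)"
  unfolding lattice_ball_def by (rule finite_subset[OF _ finite_PiE[of "{..<d}" "\<lambda>_. {- int R..int R}"]]) auto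

text \<open>Since \<open>|k| <= k^2\<close> for integers, every point of the ball has weight
  \<open>2 ^ R * 2 ^ (- sum |k i|)\<close> at least 1. The total weight over the box factorises over
  the coordinates, each contributing at most 3. Hence the count is exponential in \<open>d\<close>
  when \<open>R\<close> is proportional to \<open>d\<close>.\<close>

lemma card_lattice_ball: "real (card (lattice_ball d R)) \<le> 2 ^ R * 3 ^ d"
proof -
  have "real (card (lattice_ball d R)) = (\<Sum>k\<in>lattice_ball d R. 1)" by simp
  also have "\<dots> \<le> (\<Sum>k\<in>lattice_ball d R. 2 ^ R * (\<Prod>i<d. (1/2) ^ nat \<bar>k i\<bar>))"
  proof (rule sum_mono)
    fix k assume k: "k \<in> lattice_ball d R"
    have "int (\<Sum>i<d. nat \<bar>k i\<bar>) = (\<Sum>i<d. \<bar>k i\<bar>)" by simp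
    also have "\<dots> \<le> (\<Sum>i<d. (k i)\<^sup>2)" by (intro sum_mono abs_le_square_int)
    also have "\<dots> \<le> int R" using k by (simp add: lattice_ball_def)
    finally have le: "(\<Sum>i<d. nat \<bar>k i\<bar>) \<le> R" by linarith
    have "1 = (2::real) ^ R * (1/2) ^ R" by (simp add: power_mult_distrib[symmetric])
    also have "\<dots> \<le> 2 ^ R * (1/2) ^ (\<Sum>i<d. nat \<bar>k i\<bar>)"
      using le by (intro mult_left_mono power_decreasing) auto
    finally show "1 \<le> (2::real) ^ R * (\<Prod>i<d. (1/2) ^ nat \<bar>k i\<bar>)" by (simp add: power_sum)
  qed
  also have "\<dots> \<le> (\<Sum>k\<in>PiE {..<d} (\<lambda>_. {- int R..int R}). 2 ^ R * (\<Prod>i<d. (1/2) ^ nat \<bar>k i\<bar>))"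
    by (rule sum_mono2) (auto simp: lattice_ball_def prod_nonneg intro!: finite_PiE)
  also have "\<dots> = 2 ^ R * (\<Prod>i<d. \<Sum>k\<in>{- int R..int R}. (1/2) ^ nat \<bar>k\<bar>)"
    by (simp only: sum_distrib_left[symmetric]) (subst prod_sum_PiE, auto)
  also have "\<dots> \<le> 2 ^ R * (\<Prod>i<d. 3)"
    unfolding sum_half_power_abs using power_le_one[of "1/2::real" R]
    by (intro mult_left_mono prod_mono) auto
  finally show ?thesis by simp
qed

text \<open>With mesh \<open>1 / (10 sqrt d)\<close>, the rounding errors of \<open>d\<close>
  coordinates add up to at most \<open>1/10\<close> in Euclidean norm.\<close>

definition net_point :: "nat \<Rightarrow> (nat \<Rightarrow> int) \<Rightarrow> nat \<Rightarrow> real" where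
  "net_point d k i = real_of_int (k i) / (10 * sqrt (real d))"

lemma net_point_norm:
  assumes "d \<ge> 1" shows "(\<Sum>i<d. (net_point d k i)\<^sup>2) = real_of_int (\<Sum>i<d. (k i)\<^sup>2) / (100 * real d)"
  unfolding net_point_def by (simp add: power_divide power_mult_distrib sum_divide_distrib)

text \<open>Rounding each coordinate down gives the point. Its norm is at most
  \<open>1 + 1/10\<close>, so the integer vector has squared norm at most
  \<open>(11/10)^2 * 100 d = 121 d\<close>.\<close>

lemma net_approx:
  assumes d: "d \<ge> 1" and x: "L2_set x {..<d} \<le> 1"
  obtains k where "k \<in> lattice_ball d (121 * d)" "L2_set (\<lambda>i. x i - net_point d k i) {..<d} \<le> 1/10"
proof -
  define e where "e = 10 * sqrt (real d)"
  have e: "e > 0" using d by (simp add: e_def)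
  have e2: "e\<^sup>2 = 100 * real d" by (simp add: e_def power_mult_distrib)
  define k where "k = restrict (\<lambda>i. \<lfloor>e * x i\<rfloor>) {..<d}"
  have r: "\<bar>x i - net_point d k i\<bar> \<le> 1 / e" if "i < d" for i
  proof -
    have "net_point d k i = of_int \<lfloor>e * x i\<rfloor> / e" using that by (simp add: net_point_def k_def e_def)
    moreover have "0 \<le> (e * x i - of_int \<lfloor>e * x i\<rfloor>) / e" "(e * x i - of_int \<lfloor>e * x i\<rfloor>) / e \<le> 1 / e"
      using e by (auto intro!: divide_right_mono divide_nonneg_pos) linarith+
    moreover have "(e * x i - of_int \<lfloor>e * x i\<rfloor>) / e = x i - of_int \<lfloor>e * x i\<rfloor> / e"
      using e by (simp add: field_simps)
    ultimately show ?thesis by simp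
  qed
  have "(\<Sum>i<d. (x i - net_point d k i)\<^sup>2) \<le> (\<Sum>i<d. (1 / e)\<^sup>2)"
  proof (rule sum_mono)
    fix i assume "i \<in> {..<d}"
    then show "(x i - net_point d k i)\<^sup>2 \<le> (1 / e)\<^sup>2"
      using power_mono[OF r, of i 2] by simp
  qed
  also have "\<dots> = (1/10)\<^sup>2" using d by (simp add: power_divide e2)
  finally have res: "L2_set (\<lambda>i. x i - net_point d k i) {..<d} \<le> 1/10"
    unfolding L2_set_def by (intro real_le_lsqrt) (auto simp: sum_nonneg)
  have "L2_set (net_point d k) {..<d} \<le> L2_set x {..<d} + L2_set (\<lambda>i. net_point d k i - x i) {..<d}"
    using L2_set_triangle_ineq[of x "\<lambda>i. net_point d k i - x i" "{..<d}"] by simp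
  also have "L2_set (\<lambda>i. net_point d k i - x i) {..<d} = L2_set (\<lambda>i. x i - net_point d k i) {..<d}"
    unfolding L2_set_def by (simp add: power2_commute)
  finally have "L2_set (net_point d k) {..<d} \<le> 11/10" using x res by simp
  then have "(L2_set (net_point d k) {..<d})\<^sup>2 \<le> (11/10)\<^sup>2" by (intro power_mono) (auto simp: L2_set_nonneg)
  then have "(\<Sum>i<d. (net_point d k i)\<^sup>2) \<le> 121/100"
    by (simp add: L2_set_def sum_nonneg power2_eq_square[of "11/10::real"])
  then have "real_of_int (\<Sum>i<d. (k i)\<^sup>2) \<le> 121 * real d"
    unfolding net_point_norm[OF d] using d by (simp add: field_simps)
  then have k2: "(\<Sum>i<d. (k i)\<^sup>2) \<le> int (121 * d)" by linarith
  have "k i \<in> {- int (121 * d)..int (121 * d)}" if "i < d" for i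
  proof -
    have "\<bar>k i\<bar> \<le> (k i)\<^sup>2" by (rule abs_le_square_int)
    also have "\<dots> \<le> (\<Sum>i<d. (k i)\<^sup>2)" using that by (intro member_le_sum) auto
    finally have "\<bar>k i\<bar> \<le> int (121 * d)" using k2 by linarith
    then show ?thesis by auto
  qed
  then have "k \<in> PiE {..<d} (\<lambda>_. {- int (121 * d)..int (121 * d)})"
    by (intro PiE_I) (blast, simp add: k_def)
  then have "k \<in> lattice_ball d (121 * d)" using k2 by (simp add: lattice_ball_def)
  with res show ?thesis using that by blast
qed

text \<open>The upper bounds on the net first control the spectral norm \<open>S\<close>; this in
  turn makes the change from a unit vector to its nearby net point small enough for the lower bounds
  to carry over.\<close>

lemma lower_bound_from_net:
  fixes A :: rmat
  assumes d: "d \<ge> 1"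
    and up: "\<And>k. k \<in> lattice_ball d (121 * d) \<Longrightarrow>
      (\<Sum>i<T. (\<Sum>j<d. A (i,j) * net_point d k j)\<^sup>2) \<le> 4 * real T"
    and low: "\<And>k. k \<in> lattice_ball d (121 * d) \<Longrightarrow> (\<Sum>j<d. (net_point d k j)\<^sup>2) \<ge> 81/100 \<Longrightarrow>
      (\<Sum>i<T. (\<Sum>j<d. A (i,j) * net_point d k j)\<^sup>2) \<ge> real T / 4"
  shows "real T / 16 * (\<Sum>j<d. (x j)\<^sup>2) \<le> (\<Sum>i<T. (\<Sum>j<d. A (i,j) * x j)\<^sup>2)"
proof -
  define f where "f x = L2_set (\<lambda>i. \<Sum>j<d. A (i,j) * x j) {..<T}" for x
  define S where "S = spec_norm T d A"
  define q where "q = sqrt (real T)"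
  have q: "q \<ge> 0" by (simp add: q_def)
  have f_add: "f (\<lambda>j. x j + y j) \<le> f x + f y" for x y
    unfolding f_def distrib_left sum.distrib by (rule L2_set_triangle_ineq)
  have f_scale: "f (\<lambda>j. a * x j) = \<bar>a\<bar> * f x" for a x
  proof -
    have "(\<Sum>j<d. A (i,j) * (a * x j)) = a * (\<Sum>j<d. A (i,j) * x j)" for i
      by (simp add: sum_distrib_left mult_ac)
    then show ?thesis
      by (simp add: f_def L2_set_def power_mult_distrib sum_distrib_left[symmetric] real_sqrt_mult)
  qed
  have S: "f x \<le> S" if "L2_set x {..<d} \<le> 1" for x
  proof -
    have "(\<Sum>j<d. (x j)\<^sup>2) \<le> 1" using that by (simp add: L2_set_def)
    then show ?thesis using spec_norm_le_iff[of T d A S] by (simp add: S_def f_def L2_set_def)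
  qed
  have f_small: "f r \<le> S / 10" if "L2_set r {..<d} \<le> 1/10" for r
  proof -
    have "L2_set (\<lambda>j. 10 * r j) {..<d} \<le> 1"
      using that L2_set_right_distrib[of 10 r "{..<d}"] by simp
    then show ?thesis using S f_scale[of 10 r] by fastforce
  qed
  have up': "f (net_point d k) \<le> 2 * q" if "k \<in> lattice_ball d (121 * d)" for k
  proof -
    have "f (net_point d k) \<le> sqrt (4 * real T)"
      unfolding f_def L2_set_def using up[OF that] by simp
    then show ?thesis by (simp add: q_def real_sqrt_mult)
  qed
  have "f x \<le> 2 * q + S / 10" if x1: "L2_set x {..<d} \<le> 1" for x
  proof -
    obtain k where k: "k \<in> lattice_ball d (121 * d)" "L2_set (\<lambda>i. x i - net_point d k i) {..<d} \<le> 1/10"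
      using net_approx[OF d x1] by blast
    have "f x \<le> f (net_point d k) + f (\<lambda>i. x i - net_point d k i)"
      using f_add[of "net_point d k" "\<lambda>i. x i - net_point d k i"] by simp
    then show ?thesis using up'[OF k(1)] f_small[OF k(2)] by simp
  qed
  \<comment> \<open>The supremum bounds itself: the distance \<open>1/10\<close> to the net costs
    \<open>S / 10\<close>, and solving for \<open>S\<close> gives the factor
    \<open>20/9\<close>.\<close>
  then have "S \<le> 2 * q + S / 10"
    unfolding S_def spec_norm_le_iff by (simp add: f_def L2_set_def)
  then have S_le: "S \<le> 20/9 * q" by simp
  have unit: "f x \<ge> q / 4" if x1: "L2_set x {..<d} = 1" for x
  proof -
    obtain k where k: "k \<in> lattice_ball d (121 * d)" "L2_set (\<lambda>i. x i - net_point d k i) {..<d} \<le> 1/10"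
      using net_approx[OF d order.eq_iff[THEN iffD1, OF x1, THEN conjunct1]] by blast
    have "L2_set x {..<d} \<le> L2_set (net_point d k) {..<d} + L2_set (\<lambda>i. x i - net_point d k i) {..<d}"
      using L2_set_triangle_ineq[of "net_point d k" "\<lambda>i. x i - net_point d k i" "{..<d}"] by simp
    \<comment> \<open>The threshold \<open>81/100\<close> is \<open>(9/10)^2\<close>: a net point
      near a unit vector has norm at least \<open>9/10\<close>.\<close>
    then have "L2_set (net_point d k) {..<d} \<ge> 9/10" using x1 k(2) by simp
    then have "(L2_set (net_point d k) {..<d})\<^sup>2 \<ge> (9/10)\<^sup>2" by (intro power_mono) auto
    then have "(\<Sum>i<d. (net_point d k i)\<^sup>2) \<ge> 81/100"
      by (simp add: L2_set_def sum_nonneg power2_eq_square[of "9/10::real"])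
    from low[OF k(1) this] have "sqrt (real T / 4) \<le> f (net_point d k)"
      unfolding f_def L2_set_def by simp
    then have "q / 2 \<le> f (net_point d k)" by (simp add: q_def real_sqrt_divide)
    also have "\<dots> \<le> f x + f (\<lambda>i. net_point d k i - x i)"
      using f_add[of x "\<lambda>i. net_point d k i - x i"] by simp
    also have "f (\<lambda>i. net_point d k i - x i) = f (\<lambda>i. x i - net_point d k i)"
      using f_scale[of "-1" "\<lambda>i. x i - net_point d k i"] by simp
    \<comment> \<open>Numerically, \<open>1/2 - (20/9) / 10 = 5/18\<close>, which exceeds
      \<open>1/4\<close>.\<close>
    finally show ?thesis using f_small[OF k(2)] S_le q by simp
  qed
  define nx where "nx = L2_set x {..<d}"
  have "q / 4 * nx \<le> f x"
  proof (cases "nx = 0")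
    case True then show ?thesis by (simp add: f_def L2_set_nonneg)
  next
    case False
    then have nx: "nx > 0" using L2_set_nonneg[of x "{..<d}"] by (simp add: nx_def less_le)
    have "L2_set (\<lambda>j. inverse nx * x j) {..<d} = 1"
      using L2_set_right_distrib[of "inverse nx" x "{..<d}"] nx by (simp add: nx_def[symmetric])
    from unit[OF this] show ?thesis unfolding f_scale using nx by (simp add: field_simps)
  qed
  then have "(q / 4 * nx)\<^sup>2 \<le> (f x)\<^sup>2"
    using q by (intro power_mono) (auto simp: nx_def L2_set_nonneg)
  then show ?thesis
    by (simp add: q_def nx_def f_def L2_set_def sum_nonneg power_mult_distrib power_divide)
qed

text \<open>A Chernoff bound with exponent \<open>1/4\<close>. The moment per row is at most
  \<open>50/31\<close>, below \<open>1 + 9/10\<close> and so below \<open>exp (9/10)\<close>, while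
  the threshold \<open>4 T\<close> contributes \<open>exp (-1)\<close> per row; together each row
  gives at most \<open>exp (-1/10)\<close>.\<close>

lemma gauss_norm_upper_tail:
  assumes y: "(\<Sum>j<d. (y j)\<^sup>2) \<le> 121/100"
  shows "measure (gauss_mat T d 1) {A \<in> space (gauss_mat T d 1).
      (\<Sum>i<T. (\<Sum>j<d. A (i,j) * y j)\<^sup>2) \<ge> 4 * real T} \<le> exp (- real T / 10)"
proof -
  interpret P: prob_space "gauss_mat T d 1" by (rule prob_space_gauss_mat) simp
  define Y where "Y = (\<Sum>j<d. (y j)\<^sup>2)"
  have [measurable]: "(\<lambda>A. A ij) \<in> borel_measurable (gauss_mat T d 1)" for ij
    by (rule measurable_gauss_mat_coord)
  define c where "c = 1 / sqrt (1 - 2 * (1/4) * (1\<^sup>2 * Y))"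
  have "(31/50)\<^sup>2 \<le> 1 - 2 * (1/4) * (1\<^sup>2 * Y)" using y by (simp add: Y_def power2_eq_square)
  then have sq: "31/50 \<le> sqrt (1 - 2 * (1/4) * (1\<^sup>2 * Y))" by (rule real_le_rsqrt)
  then have c: "c \<ge> 0" "c \<le> 50/31"
    using frac_le[OF _ _ _ sq, of 1 1] y[folded Y_def] by (auto simp: c_def)
  have "(\<integral>\<^sup>+A. ennreal (exp (1/4 * (\<Sum>i<T. (\<Sum>j<d. A (i,j) * y j)\<^sup>2))) \<partial>gauss_mat T d 1) = ennreal (c ^ T)"
    unfolding c_def Y_def by (rule gauss_mat_exp_norm_square) (use y in auto)
  then have "P.prob {A \<in> space (gauss_mat T d 1). 1/4 * (\<Sum>i<T. (\<Sum>j<d. A (i,j) * y j)\<^sup>2) \<ge> real T}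
      \<le> c ^ T * exp (- real T)"
    using c by (intro P.exp_Markov) auto
  also have "c ^ T * exp (- real T) = (c * exp (-1)) ^ T"
    using exp_of_nat_mult[of T "-1::real"] by (simp add: power_mult_distrib)
  also have "\<dots> \<le> (exp (- 1/10)) ^ T"
  proof (rule power_mono)
    have "(1 + 9/10::real) \<le> exp (9/10)" by (rule exp_ge_add_one_self)
    then have "c \<le> exp (9/10)" using c by simp
    then have "c * exp (-1) \<le> exp (9/10) * exp (-1)" by (intro mult_right_mono) auto
    also have "\<dots> = exp (- 1/10::real)" by (simp add: exp_add[symmetric])
    finally show "c * exp (-1) \<le> exp (- 1/10)" .
  qed (use c in auto)
  also have "\<dots> = exp (- real T / 10)"
    using exp_of_nat_mult[of T "-1/10::real"] by simp
  finally show ?thesis by (simp add: field_simps)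
qed

text \<open>The same with exponent \<open>-1\<close>. The moment per row is at most
  \<open>5/8\<close>, below \<open>1 - 7/20\<close> and so below \<open>exp (- 7/20)\<close>; the
  threshold \<open>T / 4\<close> costs \<open>exp (1/4)\<close> per row.\<close>

lemma gauss_norm_lower_tail:
  assumes y: "(\<Sum>j<d. (y j)\<^sup>2) \<ge> 81/100"
  shows "measure (gauss_mat T d 1) {A \<in> space (gauss_mat T d 1).
      (\<Sum>i<T. (\<Sum>j<d. A (i,j) * y j)\<^sup>2) \<le> real T / 4} \<le> exp (- real T / 10)"
proof -
  interpret P: prob_space "gauss_mat T d 1" by (rule prob_space_gauss_mat) simp
  define Y where "Y = (\<Sum>j<d. (y j)\<^sup>2)"
  have [measurable]: "(\<lambda>A. A ij) \<in> borel_measurable (gauss_mat T d 1)" for ij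
    by (rule measurable_gauss_mat_coord)
  define c where "c = 1 / sqrt (1 - 2 * (-1) * (1\<^sup>2 * Y))"
  have "(8/5)\<^sup>2 \<le> 1 - 2 * (-1) * (1\<^sup>2 * Y)" using y by (simp add: Y_def power2_eq_square)
  then have sq: "8/5 \<le> sqrt (1 - 2 * (-1) * (1\<^sup>2 * Y))" by (rule real_le_rsqrt)
  then have c: "c \<ge> 0" "c \<le> 5/8"
    using frac_le[OF _ _ _ sq, of 1 1] y[folded Y_def] by (auto simp: c_def)
  have "(\<integral>\<^sup>+A. ennreal (exp ((-1) * (\<Sum>i<T. (\<Sum>j<d. A (i,j) * y j)\<^sup>2))) \<partial>gauss_mat T d 1) = ennreal (c ^ T)"
    unfolding c_def Y_def by (rule gauss_mat_exp_norm_square) (use y in auto)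
  then have "P.prob {A \<in> space (gauss_mat T d 1). (-1) * (\<Sum>i<T. (\<Sum>j<d. A (i,j) * y j)\<^sup>2) \<ge> - real T / 4}
      \<le> c ^ T * exp (- (- real T / 4))"
    using c by (intro P.exp_Markov) auto
  also have "c ^ T * exp (- (- real T / 4)) = (c * exp (1/4)) ^ T"
    using exp_of_nat_mult[of T "1/4::real"] by (simp add: power_mult_distrib)
  also have "\<dots> \<le> (exp (- 1/10)) ^ T"
  proof (rule power_mono)
    have "(1 + - 7/20::real) \<le> exp (- 7/20)" by (rule exp_ge_add_one_self)
    then have "c \<le> exp (- 7/20)" using c by simp
    then have "c * exp (1/4) \<le> exp (- 7/20) * exp (1/4)" by (intro mult_right_mono) auto
    also have "\<dots> = exp (- 1/10::real)" by (simp add: exp_add[symmetric])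
    finally show "c * exp (1/4) \<le> exp (- 1/10)" .
  qed (use c in auto)
  also have "\<dots> = exp (- real T / 10)"
    using exp_of_nat_mult[of T "-1/10::real"] by simp
  finally show ?thesis by (simp add: field_simps)
qed

text \<open>The conclusion concerns uncountably many \<open>x\<close>, so the exceptional set
  \<open>Z\<close> is built from the finitely many net points, where it is measurable and a union
  bound applies.\<close>

lemma gauss_mat_min_singular:
  assumes d: "d \<ge> 1"
  obtains Z where "Z \<in> sets (gauss_mat T d 1)"
    and "measure (gauss_mat T d 1) Z \<le> 2 * exp (123 * real d - real T / 10)"
    and "\<And>A x. A \<in> space (gauss_mat T d 1) - Z \<Longrightarrow>
      real T / 16 * (\<Sum>j<d. (x j)\<^sup>2) \<le> (\<Sum>i<T. (\<Sum>j<d. A (i,j) * x j)\<^sup>2)"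
proof -
  let ?M = "gauss_mat T d 1"
  let ?K = "lattice_ball d (121 * d)"
  interpret P: prob_space ?M by (rule prob_space_gauss_mat) simp
  have [measurable]: "(\<lambda>A. A ij) \<in> borel_measurable ?M" for ij
    by (rule measurable_gauss_mat_coord)
  define E where "E = exp (- real T / 10)"
  define Zu where "Zu k = {A \<in> space ?M. (\<Sum>i<T. (\<Sum>j<d. A (i,j) * net_point d k j)\<^sup>2) \<ge> 4 * real T}" for k
  define Zl where "Zl k = (if (\<Sum>j<d. (net_point d k j)\<^sup>2) \<ge> 81/100
    then {A \<in> space ?M. (\<Sum>i<T. (\<Sum>j<d. A (i,j) * net_point d k j)\<^sup>2) \<le> real T / 4} else {})" for k
  define Z where "Z = (\<Union>k\<in>?K. Zu k \<union> Zl k)"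
  have Zu: "Zu k \<in> sets ?M" for k unfolding Zu_def by measurable
  have Zl: "Zl k \<in> sets ?M" for k unfolding Zl_def by (cases "(\<Sum>j<d. (net_point d k j)\<^sup>2) \<ge> 81/100") auto
  have fin: "finite ?K" by (rule finite_lattice_ball)
  show ?thesis
  proof (rule that)
    show "Z \<in> sets ?M" unfolding Z_def using Zu Zl fin by (intro sets.finite_UN) auto
    have "P.prob Z \<le> (\<Sum>k\<in>?K. P.prob (Zu k \<union> Zl k))"
      unfolding Z_def using Zu Zl fin by (intro measure_UNION_le) auto
    also have "\<dots> \<le> (\<Sum>k\<in>?K. 2 * E)"
    proof (rule sum_mono)
      fix k assume "k \<in> ?K"
      then have "(\<Sum>i<d. (k i)\<^sup>2) \<le> int (121 * d)" by (simp add: lattice_ball_def)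
      then have "real_of_int (\<Sum>i<d. (k i)\<^sup>2) \<le> 121 * real d" by linarith
      then have "(\<Sum>j<d. (net_point d k j)\<^sup>2) \<le> 121/100"
        unfolding net_point_norm[OF d] using d by (simp add: field_simps)
      then have "P.prob (Zu k) \<le> E" unfolding Zu_def E_def by (rule gauss_norm_upper_tail)
      moreover have "P.prob (Zl k) \<le> E"
        unfolding Zl_def E_def using gauss_norm_lower_tail by auto
      moreover have "P.prob (Zu k \<union> Zl k) \<le> P.prob (Zu k) + P.prob (Zl k)"
        by (rule measure_Un_le[OF Zu Zl])
      ultimately show "P.prob (Zu k \<union> Zl k) \<le> 2 * E" by linarith
    qed
    also have "\<dots> = real (card ?K) * (2 * E)" by simp
    also have "\<dots> \<le> exp (123 * real d) * (2 * E)"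
    proof (rule mult_right_mono)
      have "real (card ?K) \<le> 2 ^ (121 * d) * 3 ^ d" by (rule card_lattice_ball)
      \<comment> \<open>From \<open>2 <= exp 1\<close> and \<open>3 <= exp 2\<close>, the exponent
        is \<open>121 d + 2 d = 123 d\<close>.\<close>
      also have "\<dots> \<le> exp 1 ^ (121 * d) * exp 2 ^ d"
        using exp_ge_add_one_self[of "1::real"] exp_ge_add_one_self[of "2::real"]
        by (intro mult_mono power_mono) auto
      also have "\<dots> = exp (123 * real d)"
        by (simp add: exp_of_nat_mult[symmetric] exp_add[symmetric])
      finally show "real (card ?K) \<le> exp (123 * real d)" .
    qed (simp add: E_def)
    also have "\<dots> = 2 * exp (123 * real d - real T / 10)"
      using exp_add[of "123 * real d" "- real T / 10"] by (simp add: E_def)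
    finally show "P.prob Z \<le> 2 * exp (123 * real d - real T / 10)" .
  next
    fix A x assume A: "A \<in> space ?M - Z"
    show "real T / 16 * (\<Sum>j<d. (x j)\<^sup>2) \<le> (\<Sum>i<T. (\<Sum>j<d. A (i,j) * x j)\<^sup>2)"
    proof (rule lower_bound_from_net[OF d])
      fix k assume k: "k \<in> ?K"
      then have "A \<notin> Zu k" "A \<notin> Zl k" using A by (auto simp: Z_def)
      then show "(\<Sum>i<T. (\<Sum>j<d. A (i,j) * net_point d k j)\<^sup>2) \<le> 4 * real T"
        using A by (auto simp: Zu_def)
      assume "(\<Sum>j<d. (net_point d k j)\<^sup>2) \<ge> 81/100"
      with \<open>A \<notin> Zl k\<close> show "(\<Sum>i<T. (\<Sum>j<d. A (i,j) * net_point d k j)\<^sup>2) \<ge> real T / 4"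
        using A by (auto simp: Zl_def)
    qed
  qed
qed

section \<open>Block Hankel matrices and the discrete Fourier transform\<close>

text \<open>The ratio of this geometric sum is an \<open>N\<close>-th root of unity, so the sum
  vanishes unless the ratio is 1. An integer \<open>k\<close> allows differences of frequencies, as
  orthogonality requires.\<close>

lemma sum_cis_root_of_unity:
  fixes N :: nat and k :: int
  assumes "N > 0"
  shows "(\<Sum>j<N. cis (2 * pi * real_of_int k * real j / real N)) = (if int N dvd k then of_nat N else 0)"
proof -
  define \<zeta> where "\<zeta> = cis (2 * pi * real_of_int k / real N)"
  have pow: "cis (2 * pi * real_of_int k * real j / real N) = \<zeta> ^ j" for j
    unfolding \<zeta>_def Complex.DeMoivre by (rule arg_cong[where f = cis]) (simp add: mult_ac)
  have one: "\<zeta> = 1 \<longleftrightarrow> int N dvd k"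
  proof
    assume "\<zeta> = 1"
    then have "cos (2 * pi * real_of_int k / real N) = 1"
      unfolding \<zeta>_def by (metis cis.sel(1) one_complex.sel(1))
    then obtain x :: int where "2 * pi * real_of_int k / real N = of_int x * 2 * pi"
      unfolding cos_one_2pi_int by auto
    then have "pi * (2 * real_of_int k) = pi * (2 * (of_int x * real N))"
      using assms by (simp add: field_simps)
    then have "real_of_int k = real_of_int (x * int N)" by simp
    then have "k = x * int N" by (simp only: of_int_eq_iff)
    then show "int N dvd k" by simp
  next
    assume "int N dvd k"
    then obtain x where "k = int N * x" by (auto elim: dvdE)
    then have "2 * pi * real_of_int k / real N = 2 * pi * of_int x"
      using assms by simp
    then show "\<zeta> = 1" unfolding \<zeta>_def by (simp add: cis_multiple_2pi)
  qed
  have "\<zeta> ^ N = cis (2 * pi * real_of_int k)"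
    using assms unfolding \<zeta>_def Complex.DeMoivre by simp
  also have "\<dots> = 1" by (simp add: cis_multiple_2pi)
  finally have N: "\<zeta> ^ N = 1" .
  show ?thesis
  proof (cases "\<zeta> = 1")
    case True then show ?thesis using one by (simp add: pow)
  next
    case False
    then show ?thesis using one geometric_sum[of \<zeta> N] N by (simp add: pow)
  qed
qed

definition dft_char :: "nat \<Rightarrow> nat \<Rightarrow> nat \<Rightarrow> complex" where
  "dft_char N j k = cis (2 * pi * real j * real k / real N)"

lemma dft_char_commute: "dft_char N j k = dft_char N k j"
  by (simp add: dft_char_def mult_ac)

lemma dft_char_add_right: "dft_char N k (j + j') = dft_char N k j * dft_char N k j'"
  by (simp add: dft_char_def cis_mult add_divide_distrib[symmetric] distrib_left distrib_right)

lemma dft_char_orthogonal: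
  assumes "N > 0" "a < N" "b < N"
  shows "(\<Sum>j<N. dft_char N j a * cnj (dft_char N j b)) = (if a = b then of_nat N else 0)"
proof -
  have "dft_char N j a * cnj (dft_char N j b) = cis (2 * pi * real_of_int (int a - int b) * real j / real N)" for j
    unfolding dft_char_def cis_cnj cis_mult
    by (rule arg_cong[where f = cis]) (simp add: field_simps diff_divide_distrib)
  then have "(\<Sum>j<N. dft_char N j a * cnj (dft_char N j b)) = (if int N dvd int a - int b then of_nat N else 0)"
    by (simp only: sum_cis_root_of_unity[OF assms(1)])
  moreover have "int N dvd int a - int b \<longleftrightarrow> a = b"
  proof
    assume "int N dvd int a - int b"
    moreover have "\<bar>int a - int b\<bar> < int N" using assms by linarith
    ultimately have "int a - int b = 0" using zdvd_not_zless[of "\<bar>int a - int b\<bar>" "int N"] by force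
    then show "a = b" by simp
  qed simp
  ultimately show ?thesis by simp
qed

lemma dft_parseval:
  assumes "N > 0"
  shows "(\<Sum>j<N. (cmod (\<Sum>k<N. u k * dft_char N j k))\<^sup>2) = real N * (\<Sum>k<N. (cmod (u k))\<^sup>2)"
proof -
  have "complex_of_real (\<Sum>j<N. (cmod (\<Sum>k<N. u k * dft_char N j k))\<^sup>2)
      = (\<Sum>j<N. (\<Sum>k<N. u k * dft_char N j k) * cnj (\<Sum>k<N. u k * dft_char N j k))"
    by (simp only: of_real_sum complex_norm_square)
  also have "\<dots> = (\<Sum>j<N. \<Sum>k<N. \<Sum>l<N. (u k * cnj (u l)) * (dft_char N j k * cnj (dft_char N j l)))"
    by (simp add: sum_product mult_ac)
  also have "\<dots> = (\<Sum>k<N. \<Sum>j<N. \<Sum>l<N. (u k * cnj (u l)) * (dft_char N j k * cnj (dft_char N j l)))"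
    by (rule sum.swap)
  also have "\<dots> = (\<Sum>k<N. \<Sum>l<N. \<Sum>j<N. (u k * cnj (u l)) * (dft_char N j k * cnj (dft_char N j l)))"
    by (intro sum.cong refl sum.swap)
  also have "\<dots> = (\<Sum>k<N. \<Sum>l<N. if k = l then (u k * cnj (u l)) * of_nat N else 0)"
    unfolding sum_distrib_left[symmetric]
    by (intro sum.cong refl) (simp add: dft_char_orthogonal[OF assms])
  also have "\<dots> = (\<Sum>k<N. u k * cnj (u k) * of_nat N)"
    by (simp add: sum.delta)
  also have "\<dots> = complex_of_real (real N * (\<Sum>k<N. (cmod (u k))\<^sup>2))"
    by (simp only: of_real_mult of_real_sum complex_norm_square sum_distrib_left of_real_of_nat_eq mult_ac)
  finally show ?thesis by (simp only: of_real_eq_iff)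
qed

lemma dft_inversion:
  assumes "k < N"
  shows "(\<Sum>j<N. (\<Sum>l<N. u l * cnj (dft_char N j l)) * dft_char N j k) = of_nat N * u k"
proof -
  have N: "N > 0" using assms by simp
  have "(\<Sum>j<N. (\<Sum>l<N. u l * cnj (dft_char N j l)) * dft_char N j k)
      = (\<Sum>j<N. \<Sum>l<N. u l * (dft_char N j k * cnj (dft_char N j l)))"
    by (simp add: sum_distrib_right sum_distrib_left mult_ac)
  also have "\<dots> = (\<Sum>l<N. \<Sum>j<N. u l * (dft_char N j k * cnj (dft_char N j l)))"
    by (rule sum.swap)
  also have "\<dots> = (\<Sum>l<N. if k = l then u l * of_nat N else 0)"
    unfolding sum_distrib_left[symmetric]
    by (intro sum.cong refl) (simp add: dft_char_orthogonal[OF N assms])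
  also have "\<dots> = of_nat N * u k" using assms by (simp add: sum.delta)
  finally show ?thesis .
qed

section \<open>Block Hankel products in Fourier coordinates\<close>

lemma sum_div_mod:
  fixes f :: "nat \<Rightarrow> nat \<Rightarrow> 'a::comm_monoid_add"
  assumes "q > 0"
  shows "(\<Sum>i<q * n. f (i div q) (i mod q)) = (\<Sum>J<n. \<Sum>a<q. f J a)"
proof -
  have "(\<Sum>J<n. \<Sum>a<q. f J a) = (\<Sum>(J,a)\<in>{..<n} \<times> {..<q}. f J a)"
    by (simp add: sum.cartesian_product)
  also have "\<dots> = (\<Sum>i<q * n. f (i div q) (i mod q))"
  proof (rule sum.reindex_bij_witness[of _ "\<lambda>i. (i div q, i mod q)" "\<lambda>(J,a). J * q + a"])
    fix t assume t: "t \<in> {..<n} \<times> {..<q}"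
    obtain J a where ta: "t = (J,a)" by (cases t)
    have "J * q + a < Suc J * q" using t ta by simp
    also have "\<dots> \<le> n * q" using t ta by (intro mult_right_mono) auto
    finally show "(case t of (J, a) \<Rightarrow> J * q + a) \<in> {..<q * n}" by (simp add: ta mult.commute)
  qed (use assms in \<open>auto simp: less_mult_imp_div_less mult.commute\<close>)
  finally show ?thesis by simp
qed

text \<open>Entry \<open>(a, b)\<close> of the \<open>j\<close>-th Fourier coefficient of the block
  sequence; output index first, matching the transposed blocks in \<open>hankel\<close>.\<close>

definition dft_block :: "nat \<Rightarrow> nat \<Rightarrow> rmat \<Rightarrow> nat \<Rightarrow> nat \<Rightarrow> nat \<Rightarrow> complex" where
  "dft_block N p g j a b = (\<Sum>k<N. of_real (g (k * p + b, a)) * cnj (dft_char N j k))"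

text \<open>In Fourier coordinates the product with \<open>x\<close> acts on each frequency
  separately, by the block \<open>G j\<close>. Parseval is used once for the output and once for the
  input, and the two factors \<open>N\<close> cancel, so no dimension factor is lost.\<close>

lemma spec_norm_hankel_le:
  assumes n: "n \<ge> 1" and p: "p \<ge> 1" and m: "m \<ge> 1" and B: "B \<ge> 0"
    and bound: "\<And>j. j < 2 * n - 1 \<Longrightarrow>
      (\<Sum>a<m. \<Sum>b<p. (cmod (dft_block (2 * n - 1) p g j a b))\<^sup>2) \<le> B\<^sup>2"
    and x: "(\<Sum>j<p * n. (x j)\<^sup>2) \<le> 1"
  shows "sqrt (\<Sum>i<m * n. (\<Sum>j<p * n. hankel n m p g (i,j) * x j)\<^sup>2) \<le> B"
proof -
  define N where "N = 2 * n - 1"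
  have N: "N > 0" using n by (simp add: N_def)
  \<comment> \<open>The input blocks are padded with zeros from length \<open>n\<close> to the
    period \<open>N\<close>.\<close>
  define X where "X K b = (if K < n then x (K * p + b) else 0)" for K b
  define xt where "xt j b = (\<Sum>K<N. of_real (X K b) * dft_char N j K)" for j b
  define G where "G = dft_block N p g"
  define Y where "Y J a = (\<Sum>K<n. \<Sum>b<p. g ((J + K) * p + b, a) * X K b)" for J a
  define c where "c a j = (\<Sum>b<p. G j a b * xt j b)" for a j
  have hx: "(\<Sum>j<p * n. hankel n m p g (i,j) * x j) = Y (i div m) (i mod m)" if "i < m * n" for i
  proof -
    have "(\<Sum>j<p * n. hankel n m p g (i,j) * x j)
        = (\<Sum>j<p * n. g ((i div m + j div p) * p + j mod p, i mod m) * x (j div p * p + j mod p))"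
      using that by (intro sum.cong refl) (simp add: hankel_def)
    also have "\<dots> = (\<Sum>K<n. \<Sum>b<p. g ((i div m + K) * p + b, i mod m) * x (K * p + b))"
      using p by (intro sum_div_mod) simp
    also have "\<dots> = Y (i div m) (i mod m)"
      unfolding Y_def X_def by (intro sum.cong refl) simp
    finally show ?thesis .
  qed
  have Yc: "of_nat N * complex_of_real (Y J a) = (\<Sum>j<N. c a j * dft_char N J j)" if "J < n" for J a
  proof -
    have "of_nat N * complex_of_real (Y J a)
        = (\<Sum>K<n. \<Sum>b<p. of_nat N * of_real (g ((J + K) * p + b, a)) * of_real (X K b))"
      unfolding Y_def by (simp add: sum_distrib_left mult_ac)
    also have "\<dots> = (\<Sum>K<n. \<Sum>b<p. (\<Sum>j<N. G j a b * dft_char N j (J + K)) * of_real (X K b))"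
    proof (intro sum.cong refl)
      fix K b assume "K \<in> {..<n}"
      \<comment> \<open>\<open>J + K\<close> is at most \<open>2 n - 2\<close>, so the period
        \<open>2 n - 1\<close> leaves no wrap-around and Fourier inversion recovers the block
        exactly.\<close>
      then have "J + K < N" using that by (simp add: N_def)
      from dft_inversion[OF this, of "\<lambda>k. of_real (g (k * p + b, a))"]
      show "of_nat N * of_real (g ((J + K) * p + b, a)) * complex_of_real (X K b)
          = (\<Sum>j<N. G j a b * dft_char N j (J + K)) * of_real (X K b)"
        by (simp add: G_def dft_block_def)
    qed
    also have "\<dots> = (\<Sum>K<N. \<Sum>b<p. (\<Sum>j<N. G j a b * dft_char N j (J + K)) * of_real (X K b))"
      using n by (intro sum.mono_neutral_left) (auto simp: N_def X_def)
    also have "\<dots> = (\<Sum>K<N. \<Sum>b<p. \<Sum>j<N. G j a b * (of_real (X K b) * dft_char N j K) * dft_char N j J)"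
      by (simp add: sum_distrib_right sum_distrib_left dft_char_add_right mult_ac)
    also have "\<dots> = (\<Sum>b<p. \<Sum>K<N. \<Sum>j<N. G j a b * (of_real (X K b) * dft_char N j K) * dft_char N j J)"
      by (rule sum.swap)
    also have "\<dots> = (\<Sum>b<p. \<Sum>j<N. \<Sum>K<N. G j a b * (of_real (X K b) * dft_char N j K) * dft_char N j J)"
      by (intro sum.cong refl sum.swap)
    also have "\<dots> = (\<Sum>j<N. \<Sum>b<p. \<Sum>K<N. G j a b * (of_real (X K b) * dft_char N j K) * dft_char N j J)"
      by (rule sum.swap)
    also have "\<dots> = (\<Sum>j<N. c a j * dft_char N j J)"
      unfolding c_def xt_def by (simp add: sum_distrib_left sum_distrib_right)
    also have "\<dots> = (\<Sum>j<N. c a j * dft_char N J j)"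
      by (simp only: dft_char_commute[of N _ J])
    finally show ?thesis .
  qed
  have Y2: "real N * (\<Sum>J<n. (Y J a)\<^sup>2) \<le> (\<Sum>j<N. (cmod (c a j))\<^sup>2)" for a
  proof -
    have "(real N)\<^sup>2 * (\<Sum>J<n. (Y J a)\<^sup>2) = (\<Sum>J<n. (cmod (of_nat N * complex_of_real (Y J a)))\<^sup>2)"
      by (simp add: sum_distrib_left norm_mult power_mult_distrib)
    also have "\<dots> = (\<Sum>J<n. (cmod (\<Sum>j<N. c a j * dft_char N J j))\<^sup>2)"
      by (intro sum.cong refl) (simp only: Yc lessThan_iff)
    \<comment> \<open>The added block rows complete the cyclic matrix; they only increase the sum,
      and Parseval then applies.\<close>
    also have "\<dots> \<le> (\<Sum>J<N. (cmod (\<Sum>j<N. c a j * dft_char N J j))\<^sup>2)"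
      using n by (intro sum_mono2) (auto simp: N_def)
    also have "\<dots> = real N * (\<Sum>j<N. (cmod (c a j))\<^sup>2)"
      by (rule dft_parseval[OF N])
    finally show ?thesis using N by (simp add: power2_eq_square)
  qed
  \<comment> \<open>Cauchy-Schwarz over the input index; summed over \<open>a\<close>, it bounds the
    action of \<open>G j\<close> by its Frobenius norm.\<close>
  have c2: "(cmod (c a j))\<^sup>2 \<le> (\<Sum>b<p. (cmod (G j a b))\<^sup>2) * (\<Sum>b<p. (cmod (xt j b))\<^sup>2)" for a j
  proof -
    have "cmod (c a j) \<le> (\<Sum>b<p. cmod (G j a b) * cmod (xt j b))"
      unfolding c_def norm_mult[symmetric] by (rule norm_sum)
    then have "(cmod (c a j))\<^sup>2 \<le> (\<Sum>b<p. cmod (G j a b) * cmod (xt j b))\<^sup>2"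
      by (intro power_mono) auto
    also have "\<dots> \<le> (\<Sum>b<p. (cmod (G j a b))\<^sup>2) * (\<Sum>b<p. (cmod (xt j b))\<^sup>2)"
      by (rule Cauchy_Schwarz_ineq_sum)
    finally show ?thesis .
  qed
  have xt2: "(\<Sum>j<N. \<Sum>b<p. (cmod (xt j b))\<^sup>2) \<le> real N"
  proof -
    have "(\<Sum>j<N. \<Sum>b<p. (cmod (xt j b))\<^sup>2) = (\<Sum>b<p. \<Sum>j<N. (cmod (xt j b))\<^sup>2)"
      by (rule sum.swap)
    also have "\<dots> = (\<Sum>b<p. real N * (\<Sum>K<N. (X K b)\<^sup>2))"
      unfolding xt_def dft_parseval[OF N] by simp
    also have "\<dots> = real N * (\<Sum>K<N. \<Sum>b<p. (X K b)\<^sup>2)"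
      by (simp only: sum_distrib_left[symmetric]) (subst sum.swap, simp)
    also have "(\<Sum>K<N. \<Sum>b<p. (X K b)\<^sup>2) = (\<Sum>K<n. \<Sum>b<p. (x (K * p + b))\<^sup>2)"
      using n by (intro sum.mono_neutral_cong_right) (auto simp: N_def X_def)
    also have "\<dots> = (\<Sum>j<p * n. (x (j div p * p + j mod p))\<^sup>2)"
      using p by (intro sum_div_mod[symmetric]) simp
    also have "\<dots> \<le> 1" using x by simp
    finally show ?thesis using N by simp
  qed
  have "real N * (\<Sum>i<m * n. (\<Sum>j<p * n. hankel n m p g (i,j) * x j)\<^sup>2)
      = real N * (\<Sum>i<m * n. (Y (i div m) (i mod m))\<^sup>2)"
    using hx by simp
  also have "\<dots> = real N * (\<Sum>J<n. \<Sum>a<m. (Y J a)\<^sup>2)"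
    using m by (subst sum_div_mod) auto
  also have "\<dots> = (\<Sum>a<m. real N * (\<Sum>J<n. (Y J a)\<^sup>2))"
    by (simp only: sum_distrib_left[symmetric]) (subst sum.swap, simp)
  also have "\<dots> \<le> (\<Sum>a<m. \<Sum>j<N. (\<Sum>b<p. (cmod (G j a b))\<^sup>2) * (\<Sum>b<p. (cmod (xt j b))\<^sup>2))"
    by (intro sum_mono order_trans[OF Y2] c2)
  also have "\<dots> = (\<Sum>j<N. (\<Sum>a<m. \<Sum>b<p. (cmod (G j a b))\<^sup>2) * (\<Sum>b<p. (cmod (xt j b))\<^sup>2))"
    by (subst sum.swap) (simp add: sum_distrib_right)
  also have "\<dots> \<le> (\<Sum>j<N. B\<^sup>2 * (\<Sum>b<p. (cmod (xt j b))\<^sup>2))"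
    using bound by (intro sum_mono mult_right_mono) (auto simp: G_def N_def sum_nonneg)
  also have "\<dots> \<le> B\<^sup>2 * real N"
    unfolding sum_distrib_left[symmetric] using xt2 by (intro mult_left_mono) auto
  finally have "(\<Sum>i<m * n. (\<Sum>j<p * n. hankel n m p g (i,j) * x j)\<^sup>2) \<le> B\<^sup>2"
    using N by simp
  then show ?thesis using B by (intro real_le_lsqrt) (auto simp: sum_nonneg)
qed

section \<open>The estimation error\<close>

text \<open>The summands are not independent: Jensen's inequality for the exponential replaces
  independence.\<close>

lemma gauss_mat_exp_sum_squares:
  assumes \<sigma>: "\<sigma> > 0" and I: "finite I" "I \<noteq> {}" and V: "V > 0"
    and a: "\<And>e. e \<in> I \<Longrightarrow> a e < m" and w: "\<And>e. e \<in> I \<Longrightarrow> (\<Sum>t<T. (w e t)\<^sup>2) \<le> V"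
  shows "(\<integral>\<^sup>+z. ennreal (exp ((\<Sum>e\<in>I. (\<Sum>t<T. w e t * z (t, a e))\<^sup>2) / (4 * \<sigma>\<^sup>2 * V * real (card I))))
      \<partial>gauss_mat T m \<sigma>) \<le> ennreal (sqrt 2)"
proof -
  let ?M = "gauss_mat T m \<sigma>"
  define n where "n = real (card I)"
  have n: "n > 0" using I by (simp add: n_def card_gt_0_iff)
  \<comment> \<open>This makes \<open>2 * l * \<sigma>^2 * V = 1/2\<close>, so each squared form has
    exponential moment at most \<open>1 / sqrt (1/2) = sqrt 2\<close>.\<close>
  define l where "l = 1 / (4 * \<sigma>\<^sup>2 * V)"
  have l: "l > 0" using \<sigma> V by (simp add: l_def)
  define L where "L e z = (\<Sum>t<T. w e t * z (t, a e))" for e and z :: rmat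
  have [measurable]: "(\<lambda>z. z ij) \<in> borel_measurable ?M" for ij
    by (rule measurable_gauss_mat_coord)
  have L [measurable]: "L e \<in> borel_measurable ?M" for e unfolding L_def by measurable
  have each: "(\<integral>\<^sup>+z. ennreal (exp (l * (L e z)\<^sup>2)) \<partial>?M) \<le> ennreal (sqrt 2)" if e: "e \<in> I" for e
  proof -
    define K where "K = {..<T} \<times> {a e}"
    define v where "v q = w e (fst q)" for q :: "nat \<times> nat"
    have sumK: "(\<Sum>q\<in>K. f q) = (\<Sum>t<T. f (t, a e))" for f :: "nat \<times> nat \<Rightarrow> real"
      unfolding K_def by (rule sum.reindex_bij_witness[of _ "\<lambda>t. (t, a e)" fst]) auto
    have K: "K \<subseteq> {..<T} \<times> {..<m}" using a[OF e] by (auto simp: K_def)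
    define W where "W = (\<Sum>q\<in>K. (v q)\<^sup>2)"
    have "W \<le> V" unfolding W_def sumK v_def using w[OF e] by simp
    then have W: "2 * l * (\<sigma>\<^sup>2 * W) \<le> 1/2" using \<sigma> V by (simp add: l_def field_simps)
    have "(\<integral>\<^sup>+z. ennreal (exp (l * (\<Sum>q\<in>K. v q * z q)\<^sup>2)) \<partial>?M)
        = ennreal (1 / sqrt (1 - 2 * l * (\<sigma>\<^sup>2 * W)))"
      unfolding W_def by (rule gauss_mat_exp_square[OF \<sigma> K]) (use W in \<open>simp add: W_def\<close>)
    also have "1 / sqrt (1 - 2 * l * (\<sigma>\<^sup>2 * W)) \<le> 1 / sqrt (1/2)"
      using W by (intro divide_left_mono mult_pos_pos) auto
    also have "1 / sqrt (1/2) = sqrt (2::real)" by (simp add: real_sqrt_divide)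
    finally show ?thesis by (simp add: sumK v_def L_def ennreal_leI)
  qed
  have jensen: "exp (\<Sum>e\<in>I. (1 / n) * (l * (L e z)\<^sup>2)) \<le> (\<Sum>e\<in>I. (1 / n) * exp (l * (L e z)\<^sup>2))" for z
    using convex_on_sum[OF I exp_convex, of "\<lambda>_. 1 / n" "\<lambda>e. l * (L e z)\<^sup>2"] n
    by (simp add: n_def)
  have "(\<integral>\<^sup>+z. ennreal (exp ((\<Sum>e\<in>I. (L e z)\<^sup>2) / (4 * \<sigma>\<^sup>2 * V * n))) \<partial>?M)
      = (\<integral>\<^sup>+z. ennreal (exp (\<Sum>e\<in>I. (1 / n) * (l * (L e z)\<^sup>2))) \<partial>?M)"
    by (simp add: sum_divide_distrib l_def mult_ac)
  also have "\<dots> \<le> (\<integral>\<^sup>+z. (\<Sum>e\<in>I. ennreal (1 / n) * ennreal (exp (l * (L e z)\<^sup>2))) \<partial>?M)"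
    using n jensen by (intro nn_integral_mono) (auto simp: ennreal_mult'[symmetric] sum_ennreal intro!: ennreal_leI)
  also have "\<dots> = (\<Sum>e\<in>I. ennreal (1 / n) * (\<integral>\<^sup>+z. ennreal (exp (l * (L e z)\<^sup>2)) \<partial>?M))"
    by (simp add: nn_integral_sum nn_integral_cmult)
  also have "\<dots> \<le> (\<Sum>e\<in>I. ennreal (1 / n) * ennreal (sqrt 2))"
    by (intro sum_mono mult_left_mono each) auto
  also have "\<dots> = ennreal (\<Sum>e\<in>I. 1 / n * sqrt 2)"
  proof -
    have "ennreal (1 / n) * ennreal (sqrt 2) = ennreal (1 / n * sqrt 2)"
      by (rule ennreal_mult'[symmetric]) (use n in simp)
    then show ?thesis using n by (simp only:) (intro sum_ennreal, simp)
  qed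
  also have "(\<Sum>e\<in>I. 1 / n * sqrt 2) = sqrt 2" using n by (simp add: n_def)
  finally show ?thesis by (simp add: L_def n_def)
qed

text \<open>The lower bound makes \<open>A\<close> injective, so \<open>pinv\<close> is a left
  inverse and \<open>h\<close> cancels from the estimate. The second claim is
  \<open>pinv_transpose_bound\<close> with \<open>s = T / 16\<close>.\<close>

lemma ls_est_error:
  assumes dT: "d \<le> T" and T: "T > 0"
    and lower: "\<And>x. real T / 16 * (\<Sum>j<d. (x j)\<^sup>2) \<le> (\<Sum>i<T. (\<Sum>j<d. A (i,j) * x j)\<^sup>2)"
  shows "i < d \<Longrightarrow> j < m \<Longrightarrow> ls_est T d m A h z (i,j) - h (i,j) = (\<Sum>t<T. pinv T d A (i,t) * z (t,j))"
    and "(\<Sum>t<T. (\<Sum>j<d. pinv T d A (j,t) * v j)\<^sup>2) \<le> 16 * (\<Sum>j<d. (v j)\<^sup>2) / real T"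
proof -
  have inj: "\<forall>j<d. x j = 0" if "\<forall>i<T. (\<Sum>j<d. A (i,j) * x j) = 0" for x
  proof -
    have "real T / 16 * (\<Sum>j<d. (x j)\<^sup>2) \<le> 0" using lower[of x] that by simp
    then have "(\<Sum>j<d. (x j)\<^sup>2) \<le> 0" using T by (simp add: mult_le_0_iff)
    then have "(\<Sum>j<d. (x j)\<^sup>2) = 0" by (simp add: antisym sum_nonneg)
    then show ?thesis by (subst (asm) sum_nonneg_eq_0_iff) auto
  qed
  define X where "X = pinv T d A"
  have XA: "mmul d T d X A = (\<lambda>(i,j). if i < d \<and> j < d \<and> i = j then 1 else 0)"
    unfolding X_def by (rule pinv_exists_injective(2)[OF dT inj])
  obtain X' where "is_pinv T d A X'" using pinv_exists_injective(1)[OF dT inj] by blast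
  then have X: "is_pinv T d A X" using pinv_eqI[OF dT] by (simp add: X_def)
  show "ls_est T d m A h z (i,j) - h (i,j) = (\<Sum>t<T. pinv T d A (i,t) * z (t,j))" if "i < d" "j < m"
  proof -
    have "ls_est T d m A h z (i,j) = mmul d T m X (mmul T d m A h) (i,j) + (\<Sum>t<T. X (i,t) * z (t,j))"
      using that by (simp add: ls_est_def X_def[symmetric] mmul_def distrib_left sum.distrib)
    also have "mmul d T m X (mmul T d m A h) = mmul d d m (mmul d T d X A) h"
      by (simp add: mmul_assoc)
    also have "\<dots> (i,j) = (\<Sum>l<d. if i = l then h (l,j) else 0)"
      unfolding XA using that by (simp add: mmul_def if_distrib[of "\<lambda>u. u * _"] cong: if_cong)
    also have "\<dots> = h (i,j)" using that by simp
    finally show ?thesis by (simp add: X_def)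
  qed
  show "(\<Sum>t<T. (\<Sum>j<d. pinv T d A (j,t) * v j)\<^sup>2) \<le> 16 * (\<Sum>j<d. (v j)\<^sup>2) / real T"
    using pinv_transpose_bound[OF dT X _ lower, of v] T by (simp add: X_def mult.commute)
qed

text \<open>The combination is \<open>X^T\<close> applied to a vector supported on the rows
  \<open>k * p + b\<close>, with squared norm at most \<open>N\<close>. This yields the variance of
  one real or imaginary part of a Fourier coefficient of the error.\<close>

lemma pinv_block_combination:
  assumes p: "p > 0" and b: "b < p" and \<phi>: "\<And>k. \<bar>\<phi> k\<bar> \<le> 1"
    and X: "\<And>v. (\<Sum>t<T. (\<Sum>j<N * p. X (j,t) * v j)\<^sup>2) \<le> 16 * (\<Sum>j<N * p. (v j)\<^sup>2) / real T"
  shows "(\<Sum>t<T. (\<Sum>k<N. \<phi> k * X (k * p + b, t))\<^sup>2) \<le> 16 * real N / real T"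
proof -
  define v where "v j = (if j mod p = b then \<phi> (j div p) else 0)" for j
  have "(\<Sum>j<N * p. X (j,t) * v j) = (\<Sum>k<N. \<phi> k * X (k * p + b, t))" for t
  proof -
    have "(\<Sum>j<N * p. X (j,t) * v j)
        = (\<Sum>j<p * N. X (j div p * p + j mod p,t) * (if j mod p = b then \<phi> (j div p) else 0))"
      by (simp add: v_def mult.commute[of N p])
    also have "\<dots> = (\<Sum>k<N. \<Sum>b'<p. X (k * p + b', t) * (if b' = b then \<phi> k else 0))"
      using p by (rule sum_div_mod)
    also have "\<dots> = (\<Sum>k<N. X (k * p + b, t) * \<phi> k)"
      using b by (simp add: if_distrib[of "(*) _"] cong: if_cong)
    finally show ?thesis by (simp add: mult.commute)
  qed
  moreover have "(\<Sum>j<N * p. (v j)\<^sup>2) \<le> real N"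
  proof -
    have "(\<Sum>j<N * p. (v j)\<^sup>2) = (\<Sum>j<p * N. (if j mod p = b then \<phi> (j div p) else 0)\<^sup>2)"
      by (simp add: v_def mult.commute[of N p])
    also have "\<dots> = (\<Sum>k<N. \<Sum>b'<p. (if b' = b then \<phi> k else 0)\<^sup>2)"
      using p by (rule sum_div_mod)
    also have "\<dots> = (\<Sum>k<N. (\<phi> k)\<^sup>2)"
      using b by (simp add: if_distrib[of "\<lambda>u. u\<^sup>2"] cong: if_cong)
    also have "\<dots> \<le> (\<Sum>k<N. 1)"
      using \<phi> by (intro sum_mono) (simp add: abs_square_le_1)
    finally show ?thesis by simp
  qed
  ultimately show ?thesis
    using X[of v] by (auto elim!: order_trans intro!: divide_right_mono)
qed

text \<open>For fixed \<open>X\<close>, the real and imaginary parts of the entries of one Fourier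
  coefficient are \<open>2 * m * p\<close> linear forms in the noise. Their joint exponential moment
  and a union over the \<open>N\<close> frequencies give \<open>Q\<close>. Only the values of
  \<open>g\<close> inside its dimensions are prescribed, since the error of the estimate equals
  \<open>X z\<close> only there.\<close>

lemma hankel_noise_tail:
  assumes n: "n \<ge> 1" and m: "m \<ge> 1" and p: "p \<ge> 1" and \<sigma>: "\<sigma> > 0" and T: "T > 0"
    and N: "N = 2 * n - 1" and \<tau>: "\<tau> \<ge> 0"
    and X: "\<And>v. (\<Sum>t<T. (\<Sum>j<N * p. X (j,t) * v j)\<^sup>2) \<le> 16 * (\<Sum>j<N * p. (v j)\<^sup>2) / real T"
  obtains Q where "Q \<in> sets (gauss_mat T m \<sigma>)"
    and "measure (gauss_mat T m \<sigma>) Q \<le> real N * (sqrt 2 * exp (- \<tau>))"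
    and "\<And>z g. z \<in> space (gauss_mat T m \<sigma>) - Q \<Longrightarrow>
      (\<And>i j. i < N * p \<Longrightarrow> j < m \<Longrightarrow> g (i,j) = (\<Sum>t<T. X (i,t) * z (t,j))) \<Longrightarrow>
      spec_norm (m * n) (p * n) (hankel n m p g) \<le> sqrt (128 * \<sigma>\<^sup>2 * real (N * m * p) / real T * \<tau>)"
proof -
  let ?M = "gauss_mat T m \<sigma>"
  interpret P: prob_space ?M by (rule prob_space_gauss_mat[OF \<sigma>])
  have [measurable]: "(\<lambda>z. z ij) \<in> borel_measurable ?M" for ij
    by (rule measurable_gauss_mat_coord)
  have N0: "N > 0" using n N by simp
  define V where "V = 16 * real N / real T"
  have V: "V > 0" using N0 T by (simp add: V_def)
  \<comment> \<open>The flag selects the cosine for the real part and the sine for the imaginary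
    part; the sign of the latter disappears on squaring.\<close>
  define \<phi> where "\<phi> j e k = (if e then cos (2 * pi * real j * real k / real N)
      else sin (2 * pi * real j * real k / real N))" for j e k
  define I where "I = {..<m} \<times> {..<p} \<times> (UNIV :: bool set)"
  have I: "finite I" "I \<noteq> {}" "card I = 2 * m * p" using m p by (auto simp: I_def lessThan_empty_iff)
  define w where "w j = (\<lambda>(a :: nat, b, e) t. \<Sum>k<N. \<phi> j e k * X (k * p + b, t))" for j
  have w: "(\<Sum>t<T. (w j q t)\<^sup>2) \<le> V" if qI: "q \<in> I" for j q
  proof -
    obtain a b e where q: "q = (a,b,e)" "b < p" using qI by (auto simp: I_def)
    have "\<bar>\<phi> j e k\<bar> \<le> 1" for k by (simp add: \<phi>_def)
    then show ?thesis
      unfolding q w_def V_def case_prod_conv using p q(2) by (intro pinv_block_combination X) auto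
  qed
  define F where "F j z = (\<Sum>q\<in>I. (\<Sum>t<T. w j q t * z (t, fst q))\<^sup>2)" for j and z :: rmat
  have F [measurable]: "F j \<in> borel_measurable ?M" for j unfolding F_def by measurable
  define D where "D = 4 * \<sigma>\<^sup>2 * V * real (card I)"
  have D: "D > 0" using \<sigma> V m p by (simp add: D_def I(3))
  define Q where "Q = (\<Union>j<N. {z \<in> space ?M. F j z / D \<ge> \<tau>})"
  have EF: "(\<integral>\<^sup>+z. ennreal (exp (F j z / D)) \<partial>?M) \<le> ennreal (sqrt 2)" for j
    unfolding F_def D_def by (rule gauss_mat_exp_sum_squares[OF \<sigma> I(1,2) V _ w]) (auto simp: I_def)
  show ?thesis
  proof (rule that)
    show "Q \<in> sets ?M" unfolding Q_def by (intro sets.finite_UN) auto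
    have "P.prob Q \<le> (\<Sum>j<N. P.prob {z \<in> space ?M. F j z / D \<ge> \<tau>})"
      unfolding Q_def by (intro measure_UNION_le) auto
    also have "\<dots> \<le> (\<Sum>j<N. sqrt 2 * exp (- \<tau>))"
      by (intro sum_mono P.exp_Markov EF) auto
    finally show "P.prob Q \<le> real N * (sqrt 2 * exp (- \<tau>))" by simp
  next
    fix z g assume z: "z \<in> space ?M - Q"
      and g: "\<And>i j. i < N * p \<Longrightarrow> j < m \<Longrightarrow> g (i,j) = (\<Sum>t<T. X (i,t) * z (t,j))"
    define B where "B = sqrt (128 * \<sigma>\<^sup>2 * real (N * m * p) / real T * \<tau>)"
    \<comment> \<open>The constant is \<open>4 * 16 * 2 = 128\<close>: from the moment bound, from
      \<open>V\<close>, and from the two parts of each complex entry.\<close>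
    have B2: "B\<^sup>2 = D * \<tau>" using \<tau> by (simp add: B_def D_def V_def I(3) field_simps)
    have lin: "(\<Sum>k<N. \<phi> j e k * g (k * p + b, a)) = (\<Sum>t<T. w j (a, b, e) t * z (t, a))"
      if "a < m" "b < p" for j e a b
    proof -
      have "(\<Sum>k<N. \<phi> j e k * g (k * p + b, a)) = (\<Sum>k<N. \<Sum>t<T. \<phi> j e k * X (k * p + b, t) * z (t, a))"
      proof (rule sum.cong)
        fix k assume "k \<in> {..<N}"
        then have "Suc k * p \<le> N * p" by (intro mult_right_mono) auto
        then have "k * p + b < N * p" using that by simp
        then show "\<phi> j e k * g (k * p + b, a) = (\<Sum>t<T. \<phi> j e k * X (k * p + b, t) * z (t, a))"
          using that by (simp add: g sum_distrib_left mult.assoc)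
      qed simp
      also have "\<dots> = (\<Sum>t<T. \<Sum>k<N. \<phi> j e k * X (k * p + b, t) * z (t, a))" by (rule sum.swap)
      finally show ?thesis by (simp add: w_def sum_distrib_right)
    qed
    have blk: "(cmod (dft_block N p g j a b))\<^sup>2 = (\<Sum>e\<in>UNIV. (\<Sum>t<T. w j (a, b, e) t * z (t, a))\<^sup>2)"
      if "a < m" "b < p" for j a b
    proof -
      have "Re (dft_block N p g j a b) = (\<Sum>k<N. \<phi> j True k * g (k * p + b, a))"
        "Im (dft_block N p g j a b) = - (\<Sum>k<N. \<phi> j False k * g (k * p + b, a))"
        by (simp_all add: dft_block_def dft_char_def \<phi>_def mult.commute sum_negf)
      then show ?thesis by (simp add: cmod_power2 lin[OF that] UNIV_bool)
    qed
    have bound: "(\<Sum>a<m. \<Sum>b<p. (cmod (dft_block N p g j a b))\<^sup>2) \<le> B\<^sup>2" if "j < N" for j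
    proof -
      have "(\<Sum>a<m. \<Sum>b<p. (cmod (dft_block N p g j a b))\<^sup>2)
          = (\<Sum>a<m. \<Sum>b<p. \<Sum>e\<in>UNIV. (\<Sum>t<T. w j (a, b, e) t * z (t, a))\<^sup>2)"
        by (intro sum.cong refl) (simp add: blk)
      also have "\<dots> = F j z"
        unfolding F_def I_def by (simp add: sum.cartesian_product case_prod_beta)
      also have "\<dots> \<le> D * \<tau>"
        using z that D by (force simp: Q_def field_simps not_le)
      finally show ?thesis by (simp add: B2)
    qed
    have B0: "B \<ge> 0" using \<tau> by (simp add: B_def)
    show "spec_norm (m * n) (p * n) (hankel n m p g) \<le> sqrt (128 * \<sigma>\<^sup>2 * real (N * m * p) / real T * \<tau>)"
      unfolding B_def[symmetric] spec_norm_le_iff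
      using spec_norm_hankel_le[OF n p m B0 bound[unfolded N]] by blast
  qed
qed

text \<open>The probability left implicit in the English statement is made explicit: the failure
  probability is at most a constant times a negative power of \<open>n * p\<close>. All constants
  are chosen before the dimensions, the noise level and \<open>h\<close>.\<close>

theorem theorem3:
  "\<exists>c1 c2 c3 c4 :: real. c1 > 0 \<and> c2 > 0 \<and> c3 > 0 \<and> c4 > 0 \<and>
    (\<forall>(n::nat) (m::nat) (p::nat) (T::nat) (\<sigma>::real) (h::rmat).
       1 \<le> n \<longrightarrow> 1 \<le> m \<longrightarrow> 1 \<le> p \<longrightarrow> 0 < \<sigma> \<longrightarrow>
       real T \<ge> c1 * real m * real n * real p \<longrightarrow>
       (let d = (2 * n - 1) * p;
            M = gauss_mat T d 1 \<Otimes>\<^sub>M gauss_mat T m \<sigma>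
        in measure M {Uz \<in> space M.
              spec_norm (m * n) (p * n)
                (hankel n m p (\<lambda>ij. ls_est T d m (fst Uz) h (snd Uz) ij - h ij))
              \<le> c2 * \<sigma> * sqrt (real (m * n * p) / real T) * ln (real (n * p))}
           \<ge> 1 - c3 * real (n * p) powr (- c4)))"
  \<comment> \<open>\<open>2480\<close> makes \<open>123 d - T/10 \<le> - 2np\<close>, and \<open>32\<^sup>2 ln (np) \<ge> 512\<close> as soon as \<open>np \<ge> 2\<close>\<close>
proof (rule exI[of _ 2480], rule exI[of _ 32], rule exI[of _ 4], rule exI[of _ 1], intro conjI allI impI)
  fix n m p T :: nat and \<sigma> :: real and h :: rmat
  assume n: "1 \<le> n" and m: "1 \<le> m" and p: "1 \<le> p" and \<sigma>: "0 < \<sigma>"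
    and T: "real T \<ge> 2480 * real m * real n * real p"
  define N where "N = 2 * n - 1"
  define d where "d = N * p"
  define r where "r = real (n * p)"
  define b where "b = 32 * \<sigma> * sqrt (real (m * n * p) / real T) * ln r"
  let ?MU = "gauss_mat T d 1" and ?Mz = "gauss_mat T m \<sigma>"
  let ?M = "?MU \<Otimes>\<^sub>M ?Mz"
  define S where "S = {Uz \<in> space ?M. spec_norm (m * n) (p * n)
      (hankel n m p (\<lambda>ij. ls_est T d m (fst Uz) h (snd Uz) ij - h ij)) \<le> b}"
  interpret PU: prob_space ?MU by (rule prob_space_gauss_mat) simp
  interpret Pz: prob_space ?Mz by (rule prob_space_gauss_mat[OF \<sigma>])
  interpret PP: pair_prob_space ?MU ?Mz ..
  have "1 * 1 \<le> n * p" using n p by (intro mult_le_mono)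
  then have r1: "r \<ge> 1" unfolding r_def by linarith
  have "1 * (real n * real p) \<le> real m * (real n * real p)"
    using m by (intro mult_right_mono) auto
  then have T_r: "real T \<ge> 2480 * r" using T by (simp add: r_def mult.assoc)
  then have T0: "T > 0" using r1 by (intro Nat.gr0I) auto
  have d_r: "real d \<le> 2 * r"
  proof -
    have "d \<le> 2 * n * p" unfolding d_def N_def by (intro mult_right_mono) auto
    then have "real d \<le> real (2 * n * p)" by (simp only: of_nat_le_iff)
    then show ?thesis by (simp add: r_def)
  qed
  have dT: "d \<le> T" using d_r T_r r1 by linarith
  have d1: "d \<ge> 1" using n p by (simp add: d_def N_def Suc_le_eq)
  have "PP.prob S \<ge> 1 - 4 * r powr (- 1)"
  proof (cases "n * p = 1")
    case True \<comment> \<open>the error bound is then \<open>ln 1 = 0\<close>, but the claimed probability is negative\<close>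
    then have "1 - 4 * r powr (- 1) \<le> 0" by (simp add: r_def)
    then show ?thesis using measure_nonneg[of ?M S] by linarith
  next
    case False
    have "n * p \<noteq> 0" using n p by simp
    with False have "n * p \<ge> 2" by linarith
    then have r2: "r \<ge> 2" unfolding r_def by linarith
    have "ln 2 \<le> ln r" using r2 by simp
    \<comment> \<open>The inequality \<open>ln x <= x - 1\<close> at \<open>x = 1/2\<close> reads
      \<open>- ln 2 <= - 1/2\<close>.\<close>
    moreover have "(1/2::real) \<le> ln 2" using ln_le_minus_one[of "1/2::real"] by (simp add: ln_div)
    ultimately have lnr: "ln r \<ge> 1/2" by linarith
    obtain Z where Z: "Z \<in> sets ?MU" "PU.prob Z \<le> 2 * exp (123 * real d - real T / 10)"
      and low: "\<And>A x. A \<in> space ?MU - Z \<Longrightarrow>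
        real T / 16 * (\<Sum>j<d. (x j)\<^sup>2) \<le> (\<Sum>i<T. (\<Sum>j<d. A (i,j) * x j)\<^sup>2)"
      using gauss_mat_min_singular[OF d1, of T] by blast
    have S_sets: "S \<in> sets ?M" unfolding S_def by (rule sets_spec_norm_error[OF dT])
    define Bad where "Bad = space ?M - S"
    have Bad: "Bad \<in> sets ?M" using S_sets by (simp add: Bad_def)
    have cond: "emeasure ?Mz (Pair A -` Bad) \<le> ennreal (3 / r)" if A: "A \<in> space ?MU - Z" for A
    proof -
      define X where "X = pinv T d A"
      have err: "ls_est T d m A h z (i,j) - h (i,j) = (\<Sum>t<T. X (i,t) * z (t,j))" if "i < d" "j < m" for i j z
        unfolding X_def by (rule ls_est_error(1)[OF dT T0 low[OF A] that])
      have X: "(\<Sum>t<T. (\<Sum>j<N * p. X (j,t) * v j)\<^sup>2) \<le> 16 * (\<Sum>j<N * p. (v j)\<^sup>2) / real T" for v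
        unfolding X_def d_def[symmetric] by (rule ls_est_error(2)[OF dT T0 low[OF A]])
      \<comment> \<open>The level \<open>2 * ln r\<close> produces \<open>r^(-2)\<close>; one power
        of \<open>r\<close> pays for the union over the \<open>N <= 2 r\<close> frequencies.\<close>
      have tau: "2 * ln r \<ge> 0" using lnr by simp
      obtain Q where Q: "Q \<in> sets ?Mz" "Pz.prob Q \<le> real N * (sqrt 2 * exp (- (2 * ln r)))"
        and Qz: "\<And>z g. z \<in> space ?Mz - Q \<Longrightarrow>
          (\<And>i j. i < N * p \<Longrightarrow> j < m \<Longrightarrow> g (i,j) = (\<Sum>t<T. X (i,t) * z (t,j))) \<Longrightarrow>
          spec_norm (m * n) (p * n) (hankel n m p g)
            \<le> sqrt (128 * \<sigma>\<^sup>2 * real (N * m * p) / real T * (2 * ln r))"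
        using hankel_noise_tail[OF n m p \<sigma> T0 N_def tau X] by blast
      have sqrt_b: "sqrt (128 * \<sigma>\<^sup>2 * real (N * m * p) / real T * (2 * ln r)) \<le> b"
      proof (rule real_le_lsqrt)
        have "real (N * m * p) \<le> 2 * real (m * n * p)"
        proof -
          have "N * m * p \<le> 2 * n * m * p" unfolding N_def by (intro mult_right_mono) auto
          then have "real (N * m * p) \<le> real (2 * n * m * p)" by (simp only: of_nat_le_iff)
          then show ?thesis by (simp add: mult_ac)
        qed
        then have "128 * \<sigma>\<^sup>2 * real (N * m * p) / real T * (2 * ln r)
            \<le> 128 * \<sigma>\<^sup>2 * (2 * real (m * n * p)) / real T * (2 * ln r)"
          using lnr by (intro mult_right_mono divide_right_mono mult_left_mono) auto
        \<comment> \<open>Here \<open>128 * 2 * 2 = 512 = 32^2 / 2\<close>, and the remaining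
          \<open>1/2\<close> is then raised to \<open>ln r\<close>.\<close>
        also have "\<dots> = (32\<^sup>2 * \<sigma>\<^sup>2 * (real (m * n * p) / real T) * ln r) * (1/2)" by simp
        also have "\<dots> \<le> (32\<^sup>2 * \<sigma>\<^sup>2 * (real (m * n * p) / real T) * ln r) * ln r"
          using lnr by (intro mult_left_mono lnr mult_nonneg_nonneg) auto
        also have "\<dots> = b\<^sup>2" by (simp add: b_def power_mult_distrib power2_eq_square[of "ln r"])
        finally show "128 * \<sigma>\<^sup>2 * real (N * m * p) / real T * (2 * ln r) \<le> b\<^sup>2" .
      qed (use \<sigma> lnr in \<open>auto simp: b_def\<close>)
      have "Pair A -` Bad \<subseteq> Q"
      proof
        fix z assume "z \<in> Pair A -` Bad"
        then have Az: "(A, z) \<in> space ?M" "(A, z) \<notin> S" by (auto simp: Bad_def)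
        show "z \<in> Q"
        proof (rule ccontr)
          assume "z \<notin> Q"
          then have "z \<in> space ?Mz - Q" using Az by (auto simp: space_pair_measure)
          then have "spec_norm (m * n) (p * n) (hankel n m p (\<lambda>ij. ls_est T d m A h z ij - h ij))
              \<le> sqrt (128 * \<sigma>\<^sup>2 * real (N * m * p) / real T * (2 * ln r))"
            by (rule Qz) (auto simp: err d_def[symmetric])
          then show False using sqrt_b Az by (auto simp: S_def)
        qed
      qed
      then have "emeasure ?Mz (Pair A -` Bad) \<le> emeasure ?Mz Q"
        by (rule emeasure_mono[OF _ Q(1)])
      also have "\<dots> = ennreal (Pz.prob Q)" by (rule Pz.emeasure_eq_measure)
      also have "Pz.prob Q \<le> 3 / r"
      proof -
        have "real N \<le> 2 * r"
        proof -
          have "N * 1 \<le> 2 * n * p" unfolding N_def using p by (intro mult_mono) auto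
          then have "real (N * 1) \<le> real (2 * n * p)" by (simp only: of_nat_le_iff)
          then show ?thesis by (simp add: r_def)
        qed
        moreover have "sqrt 2 \<le> (3/2::real)" by (rule real_le_lsqrt) (auto simp: power2_eq_square)
        moreover have "exp (- (2 * ln r)) = 1 / r\<^sup>2"
          using r2 exp_of_nat_mult[of 2 "ln r"] by (simp add: exp_minus field_simps)
        ultimately have "real N * (sqrt 2 * exp (- (2 * ln r))) \<le> (2 * r) * (3/2 * (1 / r\<^sup>2))"
          using r2 by (intro mult_mono) auto
        also have "\<dots> = 3 / r" using r2 by (simp add: power2_eq_square)
        finally show ?thesis using Q(2) by linarith
      qed
      finally show ?thesis by (simp add: ennreal_leI)
    qed
    have "emeasure ?M Bad = (\<integral>\<^sup>+A. emeasure ?Mz (Pair A -` Bad) \<partial>?MU)"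
      by (rule Pz.emeasure_pair_measure_alt[OF Bad])
    \<comment> \<open>Input and noise are independent, so the bad event is integrated slice by
      slice; slices over \<open>Z\<close> are bounded trivially by 1.\<close>
    also have "\<dots> \<le> (\<integral>\<^sup>+A. indicator Z A + ennreal (3 / r) \<partial>?MU)"
    proof (rule nn_integral_mono)
      fix A assume A: "A \<in> space ?MU"
      show "emeasure ?Mz (Pair A -` Bad) \<le> indicator Z A + ennreal (3 / r)"
      proof (cases "A \<in> Z")
        case True
        have "emeasure ?Mz (Pair A -` Bad) \<le> 1"
          by (rule Pz.emeasure_le_1)
        then show ?thesis using True by (auto intro: add_increasing2)
      next
        case False
        then show ?thesis using cond[of A] A by simp
      qed
    qed
    also have "\<dots> = emeasure ?MU Z + ennreal (3 / r)"
      using Z(1) by (subst nn_integral_add) (auto simp: PU.emeasure_space_1)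
    also have "\<dots> = ennreal (PU.prob Z + 3 / r)"
      using r2 by (simp add: PU.emeasure_eq_measure ennreal_plus)
    finally have "ennreal (PP.prob Bad) \<le> ennreal (PU.prob Z + 3 / r)"
      unfolding PP.emeasure_eq_measure .
    then have "PP.prob Bad \<le> PU.prob Z + 3 / r"
      using r2 by (subst (asm) ennreal_le_iff) auto
    also have "PU.prob Z \<le> 1 / r"
    proof -
      have "exp (123 * real d - real T / 10) \<le> exp (- (2 * r))" using d_r T_r by simp
      also have "\<dots> = 1 / exp (2 * r)" by (simp add: exp_minus field_simps)
      \<comment> \<open>The 2 in the denominator offsets the factor 2 in the bound for
        \<open>Z\<close>.\<close>
      also have "\<dots> \<le> 1 / (2 * r)"
      proof (rule divide_left_mono)
        show "2 * r \<le> exp (2 * r)" using exp_ge_add_one_self[of "2 * r"] by linarith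
      qed (use r2 in auto)
      finally have "exp (123 * real d - real T / 10) \<le> 1 / (2 * r)" .
      moreover have "2 * (1 / (2 * r)) = 1 / r" by simp
      ultimately show ?thesis using Z(2) by linarith
    qed
    \<comment> \<open>The constant 4 is 3 from the noise plus 1 from the input matrix.\<close>
    finally have "PP.prob Bad \<le> 4 / r" by simp
    moreover have "PP.prob Bad = 1 - PP.prob S"
      unfolding Bad_def by (rule PP.prob_compl[OF S_sets])
    moreover have "r powr (- 1) = 1 / r" using r2 by (simp add: powr_minus field_simps)
    ultimately show ?thesis by simp
  qed
  then show "let d = (2 * n - 1) * p;
            M = gauss_mat T d 1 \<Otimes>\<^sub>M gauss_mat T m \<sigma>
        in measure M {Uz \<in> space M.
              spec_norm (m * n) (p * n)
                (hankel n m p (\<lambda>ij. ls_est T d m (fst Uz) h (snd Uz) ij - h ij))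
              \<le> 32 * \<sigma> * sqrt (real (m * n * p) / real T) * ln (real (n * p))}
           \<ge> 1 - 4 * real (n * p) powr (- 1)"
    unfolding Let_def S_def b_def r_def d_def N_def .
qed auto

end
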